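(* Let $n$ be an integer and $g$ odd with $3\le g<n$, and let $\gamma$ be an integer with $\lceil g/3\rceil\le\gamma\le\gamma_g$. Among all unicyclic graphs of order $n$ whose unique cycle has (odd) length $g$ and whose domination number is $\gamma$, the graph $V_n^\gamma(g)$ is the unique one attaining the minimum value of $q_{\min}$.
   Context: All graphs are finite and simple. A graph is unicyclic if it is connected and contains exactly one cycle. For a graph $G$ with degree diagonal matrix $D(G)$ and adjacency matrix $A(G)$, the signless Laplacian is $Q(G)=D(G)+A(G)$, and $q_{\min}(G)$ denotes its least eigenvalue. The domination number $\gamma(G)$ is the minimum size of a set $S\subseteq V(G)$ such that every vertex outside $S$ has a neighbor in $S$. For odd $g$ with $3\le g<n$ and $1\le k\le n-g$, $U_n^k(g)$ denotes the unicyclic graph on $n$ vertices obtained from a cycle $C_g$ and a star $S_{1,k}$ (center plus $k$ leaves) by joining a vertex of the cycle to the center of the star by a path $P_l$ on $l=n+1-g-k$ vertices, the endpoints of the path being identified with the cycle vertex and the star center respectively (when $l=1$ the cycle vertex and the star center are identified). Let $\gamma_g=\gamma(U_n^1(g))$. For each integer $\gamma$ with $\lceil g/3\rceil\le\gamma\le\gamma_g$ there is at least one $k$ with $\gamma(U_n^k(g))=\gamma$, and $V_n^\gamma(g)$ denotes $U_n^k(g)$ for the minimum such $k$. *)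

theory Defs
  imports
    "Graph_Theory.Graph_Theory"
    "Jordan_Normal_Form.Spectral_Radius"
begin

text \<open>
  A finite simple graph is a \<^locale>\<open>pair_graph\<close>: a finite vertex set with a symmetric
  irreflexive relation \<^const>\<open>parcs\<close>, so that an edge \<open>uv\<close> is the pair of arcs
  \<open>(u, v)\<close>, \<open>(v, u)\<close>.
\<close>

subsection \<open>Unicyclic graphs\<close>

text \<open>
  A cycle is identified with its set of undirected edges: one cycle is traversed by several
  closed walks, which differ by starting point and direction. The bound on the length is
  needed because \<^const>\<open>pre_digraph.cycle\<close> also admits \<open>u v u\<close>, which runs back and forth
  along one edge.
\<close>
definition graph_cycles :: "'a pair_pre_digraph \<Rightarrow> 'a set set set" where
  "graph_cycles G =
    {(\<lambda>(u, v). {u, v}) ` set p | p. pre_digraph.cycle (with_proj G) p \<and> 3 \<le> length p}"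

definition unicyclic :: "'a pair_pre_digraph \<Rightarrow> bool" where
  "unicyclic G \<longleftrightarrow>
    pair_graph G \<and> Digraph_Component.connected (with_proj G) \<and> (\<exists>!C. C \<in> graph_cycles G)"


subsection \<open>Domination number\<close>

definition dominating_set :: "'a pair_pre_digraph \<Rightarrow> 'a set \<Rightarrow> bool" where
  "dominating_set G S \<longleftrightarrow>
    S \<subseteq> pverts G \<and> (\<forall>v \<in> pverts G - S. \<exists>u \<in> S. (v, u) \<in> parcs G)"

definition domination_number :: "'a pair_pre_digraph \<Rightarrow> nat" where
  "domination_number G = Min (card ` {S. dominating_set G S})"

definition unicyclic_class :: "nat \<Rightarrow> nat \<Rightarrow> nat \<Rightarrow> 'a pair_pre_digraph set" where
  "unicyclic_class n g \<gamma> =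
    {G. unicyclic G \<and> card (pverts G) = n \<and> (\<forall>C \<in> graph_cycles G. card C = g) \<and>
        domination_number G = \<gamma>}"


subsection \<open>Signless Laplacian\<close>

text \<open>
  Rows and columns of a \<^typ>\<open>real mat\<close> are numbered \<open>0, ..., n - 1\<close>, so the vertices are
  listed in an arbitrary order. Another order conjugates the matrices by a permutation
  matrix, which leaves the spectrum unchanged.
\<close>
definition vertex_list :: "'a pair_pre_digraph \<Rightarrow> 'a list" where
  "vertex_list G = (SOME vs. distinct vs \<and> set vs = pverts G)"

definition adjacency_matrix :: "'a pair_pre_digraph \<Rightarrow> real mat" where
  "adjacency_matrix G = (let vs = vertex_list G; n = card (pverts G) in
    mat n n (\<lambda>(i, j). if (vs ! i, vs ! j) \<in> parcs G then 1 else 0))"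

definition degree_matrix :: "'a pair_pre_digraph \<Rightarrow> real mat" where
  "degree_matrix G = (let vs = vertex_list G; n = card (pverts G) in
    mat n n (\<lambda>(i, j). if i = j then real (out_degree (with_proj G) (vs ! i)) else 0))"

definition signless_laplacian :: "'a pair_pre_digraph \<Rightarrow> real mat" where
  "signless_laplacian G = degree_matrix G + adjacency_matrix G"

definition q_min :: "'a pair_pre_digraph \<Rightarrow> real" where
  "q_min G = Min (spectrum (signless_laplacian G))"


subsection \<open>The graphs $U_n^k(g)$ and $V_n^\gamma(g)$\<close>

text \<open>
  For \<open>3 \<le> g < n\<close> and \<open>1 \<le> k \<le> n - g\<close>, the vertices are numbered so that the cycle is
  \<open>0, ..., g - 1\<close>, the path \<open>P\<^sub>l\<close> is \<open>g - 1, g, ..., g + l - 2\<close>, where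
  \<open>g + l - 2 = n - k - 1\<close> is the centre of the star, and the leaves are \<open>n - k, ..., n - 1\<close>.
  For \<open>l = 1\<close> the path has no edge and the centre is the cycle vertex \<open>g - 1\<close>.
\<close>
definition U_graph :: "nat \<Rightarrow> nat \<Rightarrow> nat \<Rightarrow> nat pair_pre_digraph" where
  "U_graph n k g = (let l = n + 1 - g - k in
    \<lparr> pverts = {..<n},
      parcs = symcl ({(i, (i + 1) mod g) | i. i < g}
                   \<union> {(g - 1 + i, g + i) | i. i + 1 < l}
                   \<union> {(n - k - 1, j) | j. n - k \<le> j \<and> j < n}) \<rparr>)"

definition V_graph :: "nat \<Rightarrow> nat \<Rightarrow> nat \<Rightarrow> nat pair_pre_digraph" where
  "V_graph n \<gamma> g =
    U_graph n (LEAST k. 1 \<le> k \<and> k \<le> n - g \<and> domination_number (U_graph n k g) = \<gamma>) g"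

end

theory Submission
  imports Defs "HOL-Analysis.Function_Topology"
begin

text \<open>
  Grow an ordering of the vertices of a unicyclic graph from its cycle: every vertex \<open>v\<close> off the
  cycle has one smaller neighbour \<open>p v\<close>, and an edge beyond the cycle and these parent edges would
  close a second cycle. Domination numbers enter only through the depth of the trees. A unicyclic
  graph with a vertex at distance \<open>d\<close> from the cycle retracts onto the cycle with a path of length
  \<open>d\<close>, so its domination number is at least that of \<open>U_graph n k g\<close>, where \<open>d = n - k + 1 - g\<close>;
  since the domination number of \<open>U_graph n k g\<close> changes by at most one with \<open>k\<close>, minimality of \<open>k\<close>
  bounds the depth of the graphs in the class by the depth of \<open>V_graph n \<gamma> g\<close>.

  For the eigenvalue let \<open>x\<close> be an eigenvector to the least eigenvalue \<open>\<mu>\<close>. After a change of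
  signs along the trees, \<open>x v = x (root v) + \<mu> * (\<Sum>u. N u v * x u)\<close>, where \<open>N u v\<close> counts the
  common ancestors of \<open>u\<close> and \<open>v\<close> off the cycle. Among all forests of bounded depth the broom
  maximizes every entry of \<open>N\<close> simultaneously. Hence, with \<open>M\<close> the maximum of \<open>\<bar>x\<bar>\<close> on the cycle
  and \<open>N'\<close> the matrix of the broom, hung at the vertex where \<open>M\<close> is attained, the values
  \<open>Y v = M + \<mu> * (\<Sum>u. N' u v * \<bar>x u\<bar>)\<close> satisfy \<open>\<bar>x\<bar> \<le> Y\<close>, and the test vector that equals
  \<open>x\<close> on the cycle and \<open>Y\<close>, with alternating signs, on the broom has Rayleigh quotient at most
  \<open>\<mu>\<close>. Equality forces \<open>Y = \<bar>x\<bar>\<close>, hence equal depths, and a single root.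
\<close>


subsection \<open>The signless Laplacian as a quadratic form\<close>

text \<open>In a \<open>pair_graph\<close> each edge is two arcs, hence the halving: this is the
  bilinear form of the signless Laplacian, written without matrices.\<close>

definition edge_form :: "'a pair_pre_digraph \<Rightarrow> ('a \<Rightarrow> real) \<Rightarrow> ('a \<Rightarrow> real) \<Rightarrow> real" where
  "edge_form G x y = (\<Sum>(u, v)\<in>parcs G. (x u + x v) * (y u + y v)) / 2"

definition vertex_form :: "'a pair_pre_digraph \<Rightarrow> ('a \<Rightarrow> real) \<Rightarrow> ('a \<Rightarrow> real) \<Rightarrow> real" where
  "vertex_form G x y = (\<Sum>v\<in>pverts G. x v * y v)"

lemma edge_form_expand:
  "edge_form G (\<lambda>v. x v + t * y v) (\<lambda>v. x v + t * y v)
    = edge_form G x x + 2 * t * edge_form G x y + t\<^sup>2 * edge_form G y y"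
proof -
  let ?f = "\<lambda>x y e. (x (fst e) + x (snd e)) * (y (fst e) + y (snd e)) / 2 :: real"
  have form: "edge_form G x y = sum (?f x y) (parcs G)" for x y
    by (simp add: edge_form_def split_beta sum_divide_distrib)
  have "?f (\<lambda>v. x v + t * y v) (\<lambda>v. x v + t * y v) e
      = ?f x x e + 2 * t * ?f x y e + t\<^sup>2 * ?f y y e" for e
    by (simp add: field_simps power2_eq_square)
  then show ?thesis unfolding form by (simp only: sum.distrib sum_distrib_left)
qed

lemma vertex_form_expand:
  "vertex_form G (\<lambda>v. x v + t * y v) (\<lambda>v. x v + t * y v)
    = vertex_form G x x + 2 * t * vertex_form G x y + t\<^sup>2 * vertex_form G y y"
proof -
  have "(x v + t * y v) * (x v + t * y v) = x v * x v + 2 * t * (x v * y v) + t\<^sup>2 * (y v * y v)" for v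
    by (simp add: algebra_simps power2_eq_square)
  then show ?thesis unfolding vertex_form_def by (simp only: sum.distrib sum_distrib_left)
qed

lemma quadratic_nonneg_imp_linear_zero:
  fixes a b :: real
  assumes "\<And>t. 2 * t * a + t\<^sup>2 * b \<ge> 0"
  shows "a = 0"
proof (rule ccontr)
  assume a: "a \<noteq> 0"
  \<comment> \<open>\<open>c\<close> is positive and bounds \<open>b\<close> from above, and
    \<open>s\<close> minimizes \<open>2 * t * a + t\<^sup>2 * c\<close> over
    \<open>t\<close>.\<close>
  define c where "c = \<bar>b\<bar> + 1"
  define s where "s = - a / c"
  have c: "c > 0" "b \<le> c" by (auto simp: c_def)
  have "2 * s * a + s\<^sup>2 * b \<le> 2 * s * a + s\<^sup>2 * c"
    using c by (intro add_left_mono mult_left_mono) auto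
  also have "\<dots> = - (a\<^sup>2 / c)"
    using c by (simp add: s_def power2_eq_square)
  also have "\<dots> < 0" using a c by simp
  finally show False using assms[of s] by simp
qed

text \<open>The first variation: along \<open>x + t * y\<close> the difference of the two sides is a
  nonnegative quadratic in \<open>t\<close> without constant term, so its linear coefficient
  vanishes. This turns minimizers into eigenvectors, also for the test vector in the equality
  case.\<close>

lemma minimizer_imp_eigenvector:
  assumes "\<And>y. \<mu> * vertex_form G y y \<le> edge_form G y y"
    and "edge_form G x x = \<mu> * vertex_form G x x"
  shows "edge_form G x y = \<mu> * vertex_form G x y"
proof -
  have "2 * t * (edge_form G x y - \<mu> * vertex_form G x y)
      + t\<^sup>2 * (edge_form G y y - \<mu> * vertex_form G y y) \<ge> 0" for t
    using assms(1)[of "\<lambda>v. x v + t * y v"] assms(2)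
    by (simp add: edge_form_expand vertex_form_expand algebra_simps)
  from quadratic_nonneg_imp_linear_zero[OF this] show ?thesis by simp
qed

lemma vertex_form_pos:
  assumes "finite (pverts G)" "v \<in> pverts G" "x v \<noteq> 0"
  shows "vertex_form G x x > 0"
  unfolding vertex_form_def
  using assms by (intro sum_pos2[of _ v]) (auto simp: zero_less_mult_iff linorder_neq_iff)

lemma vertex_form_nonneg: "vertex_form G x x \<ge> 0"
  unfolding vertex_form_def by (intro sum_nonneg) auto

lemma edge_form_nonneg: "edge_form G x x \<ge> 0"
  unfolding edge_form_def by (intro divide_nonneg_pos sum_nonneg) (auto simp: split_beta)

text \<open>The edge form is minimized on the compact unit sphere of the vertex form; homogeneity
  extends the bound from the sphere to all \<open>y\<close>.\<close>

lemma edge_form_minimizer_exists: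
  assumes fin: "finite (pverts G)" and ne: "pverts G \<noteq> {}"
    and arcs: "parcs G \<subseteq> pverts G \<times> pverts G"
  obtains x \<mu> where "vertex_form G x x = 1" "edge_form G x x = \<mu>"
    "\<And>y. \<mu> * vertex_form G y y \<le> edge_form G y y"
proof -
  \<comment> \<open>Vectors are functions on the whole type. With the coordinates off
    \<open>pverts G\<close> pinned to 0 the product of the intervals is compact by Tychonoff's
    theorem, and a unit vector has its other coordinates in [-1, 1].\<close>
  define B where "B = (\<lambda>v. if v \<in> pverts G then {-1..1::real} else {0})"
  define S where "S = PiE UNIV B \<inter> {x. vertex_form G x x = 1}"
  have "compactin (product_topology (\<lambda>_. euclidean) UNIV) (PiE UNIV B)"
    by (auto simp: compactin_PiE B_def)
  then have comp: "compact (PiE UNIV B)"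
    by (simp add: euclidean_product_topology flip: compactin_euclidean_iff)
  have contv: "continuous_on UNIV (\<lambda>x. vertex_form G x x)"
    unfolding vertex_form_def
    by (intro continuous_intros continuous_on_product_coordinates)
  have conte: "continuous_on UNIV (\<lambda>x. edge_form G x x)"
    unfolding edge_form_def split_beta
    by (intro continuous_intros continuous_on_product_coordinates) auto
  have "closed {x. vertex_form G x x = 1}"
    using contv by (intro closed_Collect_eq) auto
  then have compS: "compact S" unfolding S_def using comp by (rule compact_Int_closed[rotated])
  obtain v0 where v0: "v0 \<in> pverts G" using ne by auto
  have "(\<lambda>v. if v = v0 then 1 else 0) \<in> S"
    using v0 fin by (auto simp: S_def B_def vertex_form_def if_distrib[of "\<lambda>t. _ * t"] cong: if_cong)
  then have "S \<noteq> {}" by auto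
  from continuous_attains_inf[OF compS this continuous_on_subset[OF conte subset_UNIV]]
  obtain x where x: "x \<in> S" and xmin: "\<And>y. y \<in> S \<Longrightarrow> edge_form G x x \<le> edge_form G y y"
    by auto
  have "edge_form G x x * vertex_form G y y \<le> edge_form G y y" for y
  proof (cases "vertex_form G y y = 0")
    case True
    then show ?thesis by (simp add: edge_form_nonneg)
  next
    case False
    define s where "s = vertex_form G y y"
    have s: "s > 0" using False vertex_form_nonneg[of G y] by (simp add: s_def)
    define z where "z = (\<lambda>v. if v \<in> pverts G then y v / sqrt s else 0)"
    have "vertex_form G z z = (\<Sum>v\<in>pverts G. y v * y v / s)"
      unfolding vertex_form_def z_def using s by (intro sum.cong) auto
    also have "\<dots> = 1"
      using s by (simp add: s_def vertex_form_def flip: sum_divide_distrib)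
    finally have vz: "vertex_form G z z = 1" .
    have "z v \<in> B v" for v
    proof (cases "v \<in> pverts G")
      case True
      have "z v * z v \<le> vertex_form G z z"
        unfolding vertex_form_def using True fin
        by (intro member_le_sum[of v _ "\<lambda>v. z v * z v"]) auto
      with vz have "(z v)\<^sup>2 \<le> 1" by (simp add: power2_eq_square)
      then show ?thesis using True by (simp add: B_def abs_square_le_1 abs_le_iff)
    qed (simp add: B_def z_def)
    then have zS: "z \<in> S" using vz by (auto simp: S_def)
    have "edge_form G z z = (\<Sum>(u, v)\<in>parcs G. (y u + y v) * (y u + y v) / s) / 2"
      unfolding edge_form_def z_def
      by (rule arg_cong[of _ _ "\<lambda>t. t / 2"], rule sum.cong)
         (use arcs s in \<open>auto simp flip: add_divide_distrib\<close>)
    also have "\<dots> = edge_form G y y / s"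
      by (simp add: edge_form_def split_beta flip: sum_divide_distrib)
    finally have "edge_form G x x \<le> edge_form G y y / s" using xmin[OF zS] by simp
    then show ?thesis using s by (simp add: s_def[symmetric] field_simps)
  qed
  with x show thesis by (intro that[of x "edge_form G x x"]) (auto simp: S_def)
qed

text \<open>Arc reversal shows that the \<open>y u\<close> and \<open>y v\<close> parts of the arc
  sum agree, which cancels the halving and leaves \<open>Q x\<close> tested against
  \<open>y\<close>.\<close>

lemma edge_form_eq_sum_neighbours:
  assumes "pair_graph G"
  shows "edge_form G x y = (\<Sum>v\<in>pverts G. (\<Sum>u\<in>{u\<in>pverts G. (v, u) \<in> parcs G}. x v + x u) * y v)"
proof -
  interpret pair_graph G by fact
  have sym: "(v, u) \<in> parcs G" if "(u, v) \<in> parcs G" for u v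
    using that pair_sym_arcs by (auto simp: symmetric_def sym_def)
  have "bij_betw (\<lambda>(u, v). (v, u)) (parcs G) (parcs G)"
    by (rule bij_betwI[of _ _ _ "\<lambda>(u, v). (v, u)"]) (auto intro: sym)
  then have swap: "(\<Sum>(u, v)\<in>parcs G. (x u + x v) * y v) = (\<Sum>(u, v)\<in>parcs G. (x u + x v) * y u)"
    by (subst sum.reindex_bij_betw[symmetric]) (auto simp: split_beta add.commute)
  have "edge_form G x y = (\<Sum>(u, v)\<in>parcs G. (x u + x v) * y u)"
    unfolding edge_form_def using swap
    by (simp add: distrib_left split_beta sum.distrib)
  also have "parcs G = (SIGMA v:pverts G. {u\<in>pverts G. (v, u) \<in> parcs G})"
    by (auto dest: in_arcsD1 in_arcsD2)
  also have "(\<Sum>(u, v)\<in>\<dots>. (x u + x v) * y u)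
      = (\<Sum>v\<in>pverts G. \<Sum>u\<in>{u\<in>pverts G. (v, u) \<in> parcs G}. (x v + x u) * y v)"
    by (rule sum.Sigma[symmetric]) (auto simp: pair_finite_verts)
  finally show ?thesis by (simp only: sum_distrib_right)
qed

section \<open>The spectrum of the matrix in terms of the forms\<close>

lemma vertex_list:
  assumes "finite (pverts G)"
  shows "distinct (vertex_list G)" "set (vertex_list G) = pverts G"
proof -
  have "\<exists>vs. distinct vs \<and> set vs = pverts G" using finite_distinct_list[OF assms] by auto
  then have "distinct (vertex_list G) \<and> set (vertex_list G) = pverts G"
    unfolding vertex_list_def by (rule someI_ex)
  then show "distinct (vertex_list G)" "set (vertex_list G) = pverts G" by auto
qed

lemma length_vertex_list: "finite (pverts G) \<Longrightarrow> length (vertex_list G) = card (pverts G)"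
  using vertex_list[of G] distinct_card by force

lemma bij_betw_vertex_list:
  "finite (pverts G) \<Longrightarrow> bij_betw ((!) (vertex_list G)) {..<card (pverts G)} (pverts G)"
  using bij_betw_nth[of "vertex_list G"] vertex_list[of G] length_vertex_list[of G] by simp

lemma signless_laplacian_carrier:
  "signless_laplacian G \<in> carrier_mat (card (pverts G)) (card (pverts G))"
  by (simp add: signless_laplacian_def degree_matrix_def adjacency_matrix_def Let_def)

lemma signless_laplacian_mult_vec:
  assumes "pair_graph G" and i: "i < card (pverts G)"
  shows "(signless_laplacian G *\<^sub>v vec (card (pverts G)) (\<lambda>j. x (vertex_list G ! j))) $ i
    = (\<Sum>u\<in>{u\<in>pverts G. (vertex_list G ! i, u) \<in> parcs G}. x (vertex_list G ! i) + x u)"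
proof -
  interpret pair_graph G by fact
  define n vs where "n = card (pverts G)" and "vs = vertex_list G"
  let ?N = "{u\<in>pverts G. (vs ! i, u) \<in> parcs G}"
  have bij: "bij_betw ((!) vs) {..<n} (pverts G)"
    unfolding n_def vs_def by (rule bij_betw_vertex_list[OF pair_finite_verts])
  have "out_arcs (with_proj G) (vs ! i) = Pair (vs ! i) ` ?N"
    by (auto simp: out_arcs_def dest: in_arcsD2)
  then have deg: "out_degree (with_proj G) (vs ! i) = card ?N"
    by (simp add: out_degree_def card_image inj_on_def)
  have "(signless_laplacian G *\<^sub>v vec n (\<lambda>j. x (vs ! j))) $ i
      = (\<Sum>j<n. ((if i = j then real (card ?N) else 0)
          + (if (vs ! i, vs ! j) \<in> parcs G then 1 else 0)) * x (vs ! j))"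
    using i deg unfolding n_def vs_def
    by (auto simp: signless_laplacian_def degree_matrix_def adjacency_matrix_def Let_def
        scalar_prod_def atLeast0LessThan intro!: sum.cong)
  also have "\<dots> = real (card ?N) * x (vs ! i)
      + (\<Sum>j<n. (if (vs ! i, vs ! j) \<in> parcs G then 1 else 0) * x (vs ! j))"
    using i by (simp add: distrib_right sum.distrib n_def if_distrib[of "\<lambda>t. t * _"] cong: if_cong)
  also have "(\<Sum>j<n. (if (vs ! i, vs ! j) \<in> parcs G then 1 else 0) * x (vs ! j))
      = (\<Sum>u\<in>pverts G. (if (vs ! i, u) \<in> parcs G then 1 else 0) * x u)"
    using sum.reindex_bij_betw[OF bij, of "\<lambda>u. (if (vs ! i, u) \<in> parcs G then 1 else 0) * x u"] .
  also have "\<dots> = (\<Sum>u\<in>?N. x u)"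
    by (rule sum.mono_neutral_cong_right) (auto simp: pair_finite_verts)
  finally show ?thesis by (simp add: n_def vs_def sum.distrib)
qed

text \<open>The weak form of the eigenvalue equation. It frees later arguments from the vertex order
  and lets them choose test functions \<open>y\<close> suited to the trees.\<close>

lemma eigenvalue_signless_laplacian_iff:
  assumes G: "pair_graph G"
  shows "eigenvalue (signless_laplacian G) \<mu> \<longleftrightarrow>
    (\<exists>x. (\<exists>v\<in>pverts G. x v \<noteq> 0) \<and> (\<forall>y. edge_form G x y = \<mu> * vertex_form G x y))"
proof -
  interpret pair_graph G by fact
  define n vs where "n = card (pverts G)" and "vs = vertex_list G"
  have bij: "bij_betw ((!) vs) {..<n} (pverts G)"
    unfolding n_def vs_def by (rule bij_betw_vertex_list[OF pair_finite_verts])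
  have all: "(\<forall>v\<in>pverts G. P v) \<longleftrightarrow> (\<forall>i<n. P (vs ! i))" for P
    unfolding bij_betw_imp_surj_on[OF bij, symmetric] by auto
  let ?L = "\<lambda>x v. \<Sum>u\<in>{u\<in>pverts G. (v, u) \<in> parcs G}. x v + x u"
  let ?w = "\<lambda>x. vec n (\<lambda>j. x (vs ! j)) :: real vec"
  have weak: "(\<forall>y. edge_form G x y = \<mu> * vertex_form G x y) \<longleftrightarrow> (\<forall>v\<in>pverts G. ?L x v = \<mu> * x v)"
    for x
  proof (intro iffI allI ballI)
    fix v assume *: "\<forall>y. edge_form G x y = \<mu> * vertex_form G x y" and v: "v \<in> pverts G"
    from *[rule_format, of "\<lambda>u. if u = v then 1 else 0"]
    show "?L x v = \<mu> * x v"
      using v pair_finite_verts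
      by (simp add: edge_form_eq_sum_neighbours[OF G] vertex_form_def if_distrib[of "\<lambda>t. _ * t"]
          cong: if_cong)
  next
    fix y assume *: "\<forall>v\<in>pverts G. ?L x v = \<mu> * x v"
    then show "edge_form G x y = \<mu> * vertex_form G x y"
      by (simp add: edge_form_eq_sum_neighbours[OF G] vertex_form_def sum_distrib_left mult.assoc)
  qed
  have eqs: "signless_laplacian G *\<^sub>v ?w x = \<mu> \<cdot>\<^sub>v ?w x \<longleftrightarrow> (\<forall>v\<in>pverts G. ?L x v = \<mu> * x v)" for x
  proof -
    have "signless_laplacian G *\<^sub>v ?w x = \<mu> \<cdot>\<^sub>v ?w x
        \<longleftrightarrow> (\<forall>i<n. (signless_laplacian G *\<^sub>v ?w x) $ i = \<mu> * x (vs ! i))"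
      using signless_laplacian_carrier[of G] by (auto simp: vec_eq_iff n_def)
    also have "\<dots> \<longleftrightarrow> (\<forall>i<n. ?L x (vs ! i) = \<mu> * x (vs ! i))"
      using signless_laplacian_mult_vec[OF G] by (simp add: n_def vs_def)
    finally show ?thesis unfolding all .
  qed
  have nz: "?w x \<noteq> 0\<^sub>v n \<longleftrightarrow> (\<exists>v\<in>pverts G. x v \<noteq> 0)" for x
    using all[of "\<lambda>v. x v = 0"] by (auto simp: vec_eq_iff)
  have surj: "\<exists>x. w = ?w x" if w: "w \<in> carrier_vec n" for w
  proof
    have "the_inv_into {..<n} ((!) vs) (vs ! j) = j" if "j < n" for j
      using the_inv_into_f_f[OF bij_betw_imp_inj_on[OF bij]] that by simp
    then show "w = ?w (\<lambda>v. w $ the_inv_into {..<n} ((!) vs) v)"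
      using w by (intro eq_vecI) auto
  qed
  have "eigenvalue (signless_laplacian G) \<mu>
      \<longleftrightarrow> (\<exists>w\<in>carrier_vec n. w \<noteq> 0\<^sub>v n \<and> signless_laplacian G *\<^sub>v w = \<mu> \<cdot>\<^sub>v w)"
    using signless_laplacian_carrier[of G]
    by (auto simp: eigenvalue_def eigenvector_def n_def)
  also have "\<dots> \<longleftrightarrow> (\<exists>x. ?w x \<noteq> 0\<^sub>v n \<and> signless_laplacian G *\<^sub>v ?w x = \<mu> \<cdot>\<^sub>v ?w x)"
    using surj by (metis vec_carrier)
  finally show ?thesis by (simp only: nz eqs weak)
qed

text \<open>An eigenvector \<open>y\<close> for \<open>\<nu>\<close>, tested against itself, has
  positive norm and Rayleigh quotient \<open>\<nu>\<close>, which \<open>le\<close> bounds below by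
  \<open>\<mu>\<close>.\<close>

lemma q_min_eqI:
  assumes G: "pair_graph G" and x: "v \<in> pverts G" "x v \<noteq> 0"
    and ev: "\<And>y. edge_form G x y = \<mu> * vertex_form G x y"
    and le: "\<And>y. \<mu> * vertex_form G y y \<le> edge_form G y y"
  shows "q_min G = \<mu>"
  unfolding q_min_def
proof (rule Min_eqI)
  interpret pair_graph G by fact
  show "finite (spectrum (signless_laplacian G))"
    using card_finite_spectrum(1)[OF signless_laplacian_carrier] .
  show "\<mu> \<in> spectrum (signless_laplacian G)"
    unfolding spectrum_def mem_Collect_eq eigenvalue_signless_laplacian_iff[OF G]
    by (intro exI[of _ x] conjI allI ev bexI[of _ v] x)
  fix \<nu> assume "\<nu> \<in> spectrum (signless_laplacian G)"
  then obtain y where nz: "\<exists>v\<in>pverts G. y v \<noteq> 0"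
    and y: "\<forall>z. edge_form G y z = \<nu> * vertex_form G y z"
    unfolding spectrum_def mem_Collect_eq eigenvalue_signless_laplacian_iff[OF G] by metis
  have "vertex_form G y y > 0" using nz vertex_form_pos[OF pair_finite_verts] by auto
  then show "\<mu> \<le> \<nu>" using le[of y] y[rule_format, of y] by simp
qed

lemma q_min_eigenvector:
  assumes G: "pair_graph G" and ne: "pverts G \<noteq> {}"
  obtains x v where "v \<in> pverts G" "x v \<noteq> 0" "\<And>y. edge_form G x y = q_min G * vertex_form G x y"
    and "\<And>y. q_min G * vertex_form G y y \<le> edge_form G y y"
proof -
  interpret pair_graph G by fact
  have "parcs G \<subseteq> pverts G \<times> pverts G" by (auto dest: in_arcsD1 in_arcsD2)
  from edge_form_minimizer_exists[OF pair_finite_verts ne this]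
  obtain x \<mu> where x: "vertex_form G x x = 1" "edge_form G x x = \<mu>"
    and le: "\<And>y. \<mu> * vertex_form G y y \<le> edge_form G y y" by blast
  have ev: "edge_form G x y = \<mu> * vertex_form G x y" for y
    using minimizer_imp_eigenvector[OF le] x by simp
  have "\<exists>v\<in>pverts G. x v \<noteq> 0"
  proof (rule ccontr)
    assume "\<not> (\<exists>v\<in>pverts G. x v \<noteq> 0)"
    then have "vertex_form G x x = 0" by (simp add: vertex_form_def)
    with x(1) show False by simp
  qed
  then obtain v where v: "v \<in> pverts G" "x v \<noteq> 0" by auto
  have "q_min G = \<mu>" using q_min_eqI[OF G v ev le] .
  show thesis by (rule that[of v x]) (use v ev le \<open>q_min G = \<mu>\<close> in auto)
qed


subsection \<open>Cycles as vertex lists\<close>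

text \<open>A cycle with a chosen starting vertex and direction; \<open>cycle_edges\<close> forgets
  both choices and so matches the edge sets in \<open>graph_cycles\<close>.\<close>

definition cycle_list :: "'a pair_pre_digraph \<Rightarrow> 'a list \<Rightarrow> bool" where
  "cycle_list G vs \<longleftrightarrow> 3 \<le> length vs \<and> distinct vs \<and>
    (\<forall>i<length vs. (vs ! i, vs ! (Suc i mod length vs)) \<in> parcs G)"

definition cycle_edges :: "'a list \<Rightarrow> 'a set set" where
  "cycle_edges vs = (\<lambda>i. {vs ! i, vs ! (Suc i mod length vs)}) ` {..<length vs}"

lemma pair_graph_sym: "pair_graph G \<Longrightarrow> (u, v) \<in> parcs G \<Longrightarrow> (v, u) \<in> parcs G"
  using pair_sym_digraph.pair_sym_arcs[of G]
  by (auto simp: pair_graph_def pair_pseudo_graph_def symmetric_def sym_def)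

lemma pcas_iff_nth:
  "p \<noteq> [] \<Longrightarrow> pcas u p v \<longleftrightarrow> fst (p ! 0) = u \<and> snd (last p) = v \<and>
    (\<forall>i. Suc i < length p \<longrightarrow> snd (p ! i) = fst (p ! Suc i))"
proof (induction p arbitrary: u)
  case (Cons e es)
  show ?case
  proof (cases es)
    case (Cons e' es')
    then have ne: "es \<noteq> []" by simp
    have steps: "(\<forall>i. Suc i < length (e # es) \<longrightarrow> snd ((e # es) ! i) = fst ((e # es) ! Suc i))
        \<longleftrightarrow> snd e = fst (es ! 0) \<and> (\<forall>i. Suc i < length es \<longrightarrow> snd (es ! i) = fst (es ! Suc i))"
      (is "?L \<longleftrightarrow> ?R")
    proof
      assume L: ?L
      show ?R using L[rule_format, of 0] L[rule_format, of "Suc _"] Cons by auto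
    next
      assume R: ?R
      show ?L
      proof (intro allI impI)
        fix i assume "Suc i < length (e # es)"
        then show "snd ((e # es) ! i) = fst ((e # es) ! Suc i)" using R by (cases i) auto
      qed
    qed
    show ?thesis
      unfolding pcas.simps Cons.IH[OF ne] steps nth_Cons_0 last_ConsR[OF ne] by metis
  qed auto
qed simp

lemma tl_pawalk_verts: "pcas u p v \<Longrightarrow> tl (pawalk_verts u p) = map snd p"
proof -
  have "pcas u p v \<Longrightarrow> pawalk_verts u p = u # map snd p"
    by (induction p arbitrary: u) auto
  then show "pcas u p v \<Longrightarrow> tl (pawalk_verts u p) = map snd p" by simp
qed

lemma Suc_mod_surj: "(\<lambda>i. Suc i mod m) ` {..<m} = {..<m}"
proof (cases "m = 0")
  case False
  have "(\<lambda>i. Suc i mod m) ` {..<m} \<subseteq> {..<m}" using False by auto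
  moreover have "inj_on (\<lambda>i. Suc i mod m) {..<m}"
    by (auto simp: inj_on_def mod_Suc split: if_splits)
  ultimately show ?thesis by (simp add: endo_inj_surj)
qed simp

lemma graph_cycles_eq:
  assumes G: "pair_graph G"
  shows "graph_cycles G = cycle_edges ` {vs. cycle_list G vs}"
proof (intro subset_antisym subsetI)
  interpret pair_graph G by fact
  fix C assume "C \<in> graph_cycles G"
  then obtain p where C: "C = (\<lambda>(u, v). {u, v}) ` set p" and p: "cycle p" "3 \<le> length p"
    by (auto simp: graph_cycles_def)
  from p(1) obtain u where u: "pcas u p u" "set p \<subseteq> parcs G" "distinct (tl (pawalk_verts u p))"
    by (auto simp: cycle_def awalk_def)
  \<comment> \<open>Heads rather than tails are taken because \<open>cycle\<close> asserts
    distinctness of \<open>tl (pawalk_verts u p)\<close>, which is this list. Hence the arc leaving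
    \<open>vs ! i\<close> is \<open>p ! (Suc i mod m)\<close>, shifted by one.\<close>
  define vs where "vs = map snd p"
  define m where "m = length p"
  have m: "3 \<le> m" "length vs = m" using p by (auto simp: m_def vs_def)
  have ne: "p \<noteq> []" using p(2) by auto
  have arc: "(vs ! i, vs ! (Suc i mod m)) = p ! (Suc i mod m)" if "i < m" for i
  proof -
    have "vs ! i = fst (p ! (Suc i mod m))"
    proof (cases "Suc i < m")
      case True
      then show ?thesis using u(1) ne that by (simp add: pcas_iff_nth vs_def m_def)
    next
      case False
      with that have "m = Suc i" by simp
      then show ?thesis using u(1) ne by (simp add: pcas_iff_nth vs_def m_def last_conv_nth)
    qed
    moreover have "vs ! (Suc i mod m) = snd (p ! (Suc i mod m))"
      using m by (simp add: vs_def nth_map[of "Suc i mod m"] flip: m_def)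
    ultimately show ?thesis by simp
  qed
  have "p ! (Suc i mod m) \<in> parcs G" for i
  proof -
    have "Suc i mod m < length p" using m by (simp flip: m_def)
    then show ?thesis using u(2) nth_mem by blast
  qed
  moreover have "distinct vs" using u(3) tl_pawalk_verts[OF u(1)] by (simp add: vs_def)
  ultimately have "cycle_list G vs" using m arc by (simp add: cycle_list_def)
  moreover have "C = cycle_edges vs"
  proof -
    have "set p = (!) p ` {..<m}" by (auto simp: set_conv_nth m_def)
    then have "C = (\<lambda>i. (\<lambda>(u, v). {u, v}) (p ! i)) ` {..<m}"
      unfolding C by (simp add: image_image)
    \<comment> \<open>The cyclic shift permutes the indices and so absorbs the offset.\<close>
    also have "{..<m} = (\<lambda>i. Suc i mod m) ` {..<m}" by (simp add: Suc_mod_surj)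
    also have "(\<lambda>i. (\<lambda>(u, v). {u, v}) (p ! i)) ` (\<lambda>i. Suc i mod m) ` {..<m} = cycle_edges vs"
      unfolding cycle_edges_def image_image m(2)
      by (rule image_cong) (auto simp: arc[symmetric])
    finally show ?thesis .
  qed
  ultimately show "C \<in> cycle_edges ` {vs. cycle_list G vs}" by simp
next
  interpret pair_graph G by fact
  fix C assume "C \<in> cycle_edges ` {vs. cycle_list G vs}"
  then obtain vs where vs: "cycle_list G vs" and C: "C = cycle_edges vs" by auto
  define m where "m = length vs"
  define p where "p = map (\<lambda>i. (vs ! i, vs ! (Suc i mod m))) [0..<m]"
  have m: "3 \<le> m" and dist: "distinct vs"
    and arc: "\<And>i. i < m \<Longrightarrow> (vs ! i, vs ! (Suc i mod m)) \<in> parcs G"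
    using vs by (auto simp: cycle_list_def m_def)
  have len: "length p = m" and ne: "p \<noteq> []" using m by (auto simp: p_def)
  have pc: "pcas (vs ! 0) p (vs ! 0)"
    using m ne by (subst pcas_iff_nth) (auto simp: p_def last_conv_nth)
  define js where "js = map (\<lambda>i. Suc i mod m) [0..<m]"
  have "map snd p = map ((!) vs) js" by (simp add: p_def js_def)
  moreover have "distinct js"
    unfolding js_def by (auto simp: distinct_map inj_on_def mod_Suc split: if_splits)
  moreover have "set js = {..<m}"
    using Suc_mod_surj[of m] by (simp add: js_def atLeast0LessThan)
  moreover have "inj_on ((!) vs) {..<m}" using dist by (simp add: inj_on_nth m_def)
  ultimately have "distinct (map snd p)" by (simp add: distinct_map del: map_map)
  then have "distinct (tl (pawalk_verts (vs ! 0) p))" using tl_pawalk_verts[OF pc] by simp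
  moreover have "set p \<subseteq> parcs G" using arc by (auto simp: p_def)
  moreover have "vs ! 0 \<in> pverts G" using arc[of 0] m by (auto dest: in_arcsD1)
  ultimately have "cycle p" using pc ne unfolding cycle_def awalk_def by auto
  moreover have "C = (\<lambda>(u, v). {u, v}) ` set p"
    by (auto simp: C cycle_edges_def p_def m_def[symmetric] image_image)
  ultimately show "C \<in> graph_cycles G" using len m by (auto simp: graph_cycles_def)
qed

lemma card_cycle_edges:
  assumes "cycle_list G vs"
  shows "card (cycle_edges vs) = length vs"
proof -
  define m where "m = length vs"
  have m: "3 \<le> m" and dist: "distinct vs" using assms by (auto simp: cycle_list_def m_def)
  have "inj_on (\<lambda>i. {vs ! i, vs ! (Suc i mod m)}) {..<m}"
  proof (rule inj_onI)
    fix i j assume i: "i \<in> {..<m}" and j: "j \<in> {..<m}"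
      and eq: "{vs ! i, vs ! (Suc i mod m)} = {vs ! j, vs ! (Suc j mod m)}"
    have nth: "vs ! a = vs ! b \<longleftrightarrow> a = b" if "a < m" "b < m" for a b
      using nth_eq_iff_index_eq[OF dist] that by (simp add: m_def)
    \<comment> \<open>In the second alternative \<open>i\<close> and \<open>j\<close> are successors
      of each other, which is impossible since \<open>3 \<le> m\<close>.\<close>
    have "i = j \<or> (i = Suc j mod m \<and> Suc i mod m = j)"
      using eq i j m nth by (auto simp: doubleton_eq_iff)
    then show "i = j" using i j m by (auto simp: mod_Suc split: if_splits)
  qed
  then show ?thesis by (simp add: cycle_edges_def card_image m_def)
qed

lemma cycle_list_neighbours:
  assumes "pair_graph G" "cycle_list G vs" "v \<in> set vs"
  obtains x y where "x \<noteq> y" "x \<in> set vs" "y \<in> set vs" "(v, x) \<in> parcs G" "(v, y) \<in> parcs G"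
    "{v, x} \<in> cycle_edges vs" "{v, y} \<in> cycle_edges vs"
proof -
  define m where "m = length vs"
  have m: "3 \<le> m" and dist: "distinct vs"
    and arc: "\<And>i. i < m \<Longrightarrow> (vs ! i, vs ! (Suc i mod m)) \<in> parcs G"
    using assms(2) by (auto simp: cycle_list_def m_def)
  have edge: "{vs ! i, vs ! (Suc i mod m)} \<in> cycle_edges vs" if "i < m" for i
    using that by (auto simp: cycle_edges_def m_def)
  obtain i where i: "i < m" "v = vs ! i" using assms(3) by (auto simp: in_set_conv_nth m_def)
  define j where "j = (if i = 0 then m - 1 else i - 1)"
  have j: "j < m" "Suc j mod m = i" "Suc i mod m \<noteq> j" "Suc i mod m < m"
    using i m by (auto simp: j_def mod_Suc)
  show thesis
  proof (rule that[of "vs ! (Suc i mod m)" "vs ! j"])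
    show "vs ! (Suc i mod m) \<noteq> vs ! j"
      using nth_eq_iff_index_eq[OF dist] j by (simp add: m_def)
    show "vs ! (Suc i mod m) \<in> set vs" "vs ! j \<in> set vs" using j by (auto simp: m_def)
    show "(v, vs ! (Suc i mod m)) \<in> parcs G" using arc i by simp
    show "(v, vs ! j) \<in> parcs G" using arc[OF j(1)] j(2) i pair_graph_sym[OF assms(1)] by simp
    show "{v, vs ! (Suc i mod m)} \<in> cycle_edges vs" using edge i by simp
    show "{v, vs ! j} \<in> cycle_edges vs" using edge[OF j(1)] j(2) i by (simp add: insert_commute)
  qed
qed

text \<open>Connectedness refers to the symmetrized digraph, which is the graph itself as its arcs
  are already symmetric, and every walk starting at a vertex stays in the vertex set.\<close>

lemma connected_pair_graph_iff:
  assumes "pair_graph G"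
  shows "Digraph_Component.connected (with_proj G) \<longleftrightarrow>
    pverts G \<noteq> {} \<and> (\<forall>u\<in>pverts G. \<forall>v\<in>pverts G. (u, v) \<in> (parcs G)\<^sup>*)"
proof -
  interpret pair_graph G by fact
  have "(u, v) \<in> rtrancl_on (pverts G) (parcs G) \<longleftrightarrow> (u, v) \<in> (parcs G)\<^sup>*"
    if u: "u \<in> pverts G" for u v
  proof
    assume "(u, v) \<in> (parcs G)\<^sup>*"
    then show "(u, v) \<in> rtrancl_on (pverts G) (parcs G)"
      by (induction rule: rtrancl_induct)
         (auto intro: u rtrancl_on_into_rtrancl_on dest: in_arcsD2)
  qed (rule rtrancl_on_rtranclI)
  moreover have "parcs (mk_symmetric (with_proj G)) = parcs G"
    using adj_mk_symmetric_eq[OF pair_sym_arcs] by simp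
  ultimately show ?thesis
    by (simp add: connected_def strongly_connected_def reachable_def cong: ball_cong)
qed

text \<open>When a step is prepended to a distinct path, the new first vertex is either fresh or
  already on the path; in the latter case the suffix starting there serves.\<close>

lemma rtrancl_imp_distinct_path:
  assumes "(a, b) \<in> R\<^sup>*"
  obtains xs where "xs \<noteq> []" "hd xs = a" "last xs = b" "distinct xs"
    "\<And>i. Suc i < length xs \<Longrightarrow> (xs ! i, xs ! Suc i) \<in> R"
proof -
  have "\<exists>xs. xs \<noteq> [] \<and> hd xs = a \<and> last xs = b \<and> distinct xs \<and> successively (\<lambda>x y. (x, y) \<in> R) xs"
    using assms
  proof (induction rule: converse_rtrancl_induct)
    case base
    show ?case by (rule exI[of _ "[b]"]) auto
  next
    case (step a c)
    then obtain xs where xs: "xs \<noteq> []" "hd xs = c" "last xs = b" "distinct xs"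
      "successively (\<lambda>x y. (x, y) \<in> R) xs" by auto
    show ?case
    proof (cases "a \<in> set xs")
      case True
      then obtain ys zs where "xs = ys @ a # zs" by (auto simp: in_set_conv_decomp)
      then show ?thesis using xs by (intro exI[of _ "a # zs"]) (auto simp: successively_append_iff)
    next
      case False
      then show ?thesis using xs step(1)
        by (intro exI[of _ "a # xs"]) (auto simp: successively_Cons)
    qed
  qed
  then show thesis using that by (auto simp: successively_conv_nth)
qed


subsection \<open>Cycles with rooted trees attached\<close>

text \<open>The normal form of a unicyclic graph: the cycle is numbered first, and every later
  vertex contributes one edge, to its parent.\<close>

definition rooted_cycle_graph :: "nat \<Rightarrow> nat \<Rightarrow> (nat \<Rightarrow> nat) \<Rightarrow> nat pair_pre_digraph" where
  "rooted_cycle_graph n g p = \<lparr> pverts = {..<n},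
    parcs = symcl ((\<lambda>i. (i, Suc i mod g)) ` {..<g} \<union> (\<lambda>v. (v, p v)) ` {g..<n}) \<rparr>"

text \<open>Decreasing parents encode that the parts off the cycle are trees, and let recursion and
  induction run toward the cycle.\<close>

locale rooted_cycle =
  fixes n g :: nat and p :: "nat \<Rightarrow> nat"
  assumes g_ge_3: "3 \<le> g" and g_le_n: "g \<le> n"
    and parent_less: "\<And>v. g \<le> v \<Longrightarrow> v < n \<Longrightarrow> p v < v"
begin

abbreviation "T \<equiv> rooted_cycle_graph n g p"

lemma pverts_T: "pverts T = {..<n}"
  by (simp add: rooted_cycle_graph_def)

lemma parcs_T_iff:
  "(a, b) \<in> parcs T \<longleftrightarrow>
    a < g \<and> b = Suc a mod g \<or> b < g \<and> a = Suc b mod g \<or>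
    g \<le> a \<and> a < n \<and> b = p a \<or> g \<le> b \<and> b < n \<and> a = p b"
  by (auto simp: rooted_cycle_graph_def symcl_def)

lemma Suc_mod_less: "Suc i mod g < g"
  using g_ge_3 by simp

lemma Suc_mod_neq: "i < g \<Longrightarrow> Suc i mod g \<noteq> i"
  using g_ge_3 by (auto simp: mod_Suc)

lemma pair_graph_T: "pair_graph T"
proof unfold_locales
  have lt: "Suc i mod g < n" for i using Suc_mod_less[of i] g_le_n by simp
  have pl: "p v < n" if "g \<le> v" "v < n" for v using parent_less[OF that] that by simp
  have *: "a < n \<and> b < n" if "(a, b) \<in> parcs T" for a b
    using that g_le_n lt pl unfolding parcs_T_iff by auto
  then show "\<And>e. e \<in> parcs T \<Longrightarrow> fst e \<in> pverts T" "\<And>e. e \<in> parcs T \<Longrightarrow> snd e \<in> pverts T"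
    by (auto simp: pverts_T)
  have "parcs T \<subseteq> {..<n} \<times> {..<n}" using * by auto
  then show "finite (parcs T)" by (rule finite_subset) simp
  show "finite (pverts T)" by (simp add: pverts_T)
  show "fst e \<noteq> snd e" if "e \<in> parcs T" for e
  proof -
    obtain a b where e: "e = (a, b)" by (cases e)
    have "a \<noteq> b"
      using that parent_less[of a] parent_less[of b] Suc_mod_neq[of a] Suc_mod_neq[of b]
      unfolding e parcs_T_iff by auto
    then show ?thesis by (simp add: e)
  qed
  show "symmetric (with_proj T)"
    by (auto simp: symmetric_def sym_def parcs_T_iff)
qed

lemma reach_0: "v < n \<Longrightarrow> (v, 0) \<in> (parcs T)\<^sup>*"
proof (induction v rule: less_induct)
  case (less v)
  show ?case
  proof (cases "v < g")
    case True
    show ?thesis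
    proof (cases v)
      case (Suc i)
      have "Suc i mod g = v" using Suc True by simp
      then have "(v, i) \<in> parcs T" using Suc True unfolding parcs_T_iff by auto
      moreover have "(i, 0) \<in> (parcs T)\<^sup>*" using less Suc by simp
      ultimately show ?thesis by (rule converse_rtrancl_into_rtrancl)
    qed simp
  next
    case False
    then have "(v, p v) \<in> parcs T" using less.prems unfolding parcs_T_iff by auto
    moreover have "(p v, 0) \<in> (parcs T)\<^sup>*"
      using less parent_less[of v] False by simp
    ultimately show ?thesis by (rule converse_rtrancl_into_rtrancl)
  qed
qed

lemma reach: "u < n \<Longrightarrow> v < n \<Longrightarrow> (u, v) \<in> (parcs T)\<^sup>*"
proof -
  assume u: "u < n" and v: "v < n"
  have "sym (parcs T)" by (auto simp: sym_def parcs_T_iff)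
  then have "sym ((parcs T)\<^sup>*)" by (rule sym_rtrancl)
  then have "(0, v) \<in> (parcs T)\<^sup>*" using reach_0[OF v] by (rule symD)
  with reach_0[OF u] show ?thesis by (rule rtrancl_trans)
qed

lemma connected_T: "Digraph_Component.connected (with_proj T)"
  unfolding connected_pair_graph_iff[OF pair_graph_T] pverts_T
  using reach g_ge_3 g_le_n by (auto simp: lessThan_empty_iff)

lemma cycle_list_T: "cycle_list T [0..<g]"
  using g_ge_3 by (simp add: cycle_list_def parcs_T_iff)

lemma cycle_edges_upt: "cycle_edges [0..<g] = (\<lambda>i. {i, Suc i mod g}) ` {..<g}"
  using g_ge_3 unfolding cycle_edges_def by (intro image_cong) auto

text \<open>The largest vertex of a cycle, if it were off the base cycle, would have only its parent
  as a neighbour below it, while a cycle gives it two. So the cycle lies in the base cycle, where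
  two distinct neighbours of a vertex must include its successor, and iteration goes all the way
  round.\<close>

lemma cycle_edges_T_unique:
  assumes ws: "cycle_list T ws"
  shows "cycle_edges ws = cycle_edges [0..<g]"
proof -
  have small: "w < g" if "w \<in> set ws" for w
  proof (rule ccontr)
    assume "\<not> w < g"
    define m where "m = Max (set ws)"
    have m: "m \<in> set ws" and max: "\<And>v. v \<in> set ws \<Longrightarrow> v \<le> m"
      using that by (auto simp: m_def intro: Max_in)
    have gm: "g \<le> m" using max[OF that] \<open>\<not> w < g\<close> by simp
    have "v = p m" if "v \<in> set ws" "(m, v) \<in> parcs T" for v
      using that max[of v] gm parent_less[of v] Suc_mod_less[of v] unfolding parcs_T_iff by auto
    then show False using cycle_list_neighbours[OF pair_graph_T ws m] by metis
  qed
  have adj: "b = Suc a mod g \<or> a = Suc b mod g" if "a < g" "b < g" "(a, b) \<in> parcs T" for a b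
    using that unfolding parcs_T_iff by auto
  have succ: "{a, Suc a mod g} \<in> cycle_edges ws \<and> Suc a mod g \<in> set ws" if a: "a \<in> set ws" for a
  proof -
    obtain x y where xy: "x \<noteq> y" "x \<in> set ws" "y \<in> set ws" "(a, x) \<in> parcs T" "(a, y) \<in> parcs T"
      "{a, x} \<in> cycle_edges ws" "{a, y} \<in> cycle_edges ws"
      using cycle_list_neighbours[OF pair_graph_T ws a] by metis
    have lt: "a < g" "x < g" "y < g" using small a xy by auto
    have "x = Suc a mod g \<or> y = Suc a mod g"
    proof (rule ccontr)
      assume "\<not> ?thesis"
      then have "a = Suc x mod g" "a = Suc y mod g" using adj[OF lt(1,2) xy(4)] adj[OF lt(1,3) xy(5)] by auto
      then show False using lt xy(1) by (auto simp: mod_Suc split: if_splits)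
    qed
    then show ?thesis using xy by auto
  qed
  obtain a where a: "a \<in> set ws" using ws by (cases ws) (auto simp: cycle_list_def)
  have iter: "(a + j) mod g \<in> set ws" for j
  proof (induction j)
    case 0
    then show ?case using a small[OF a] by simp
  next
    case (Suc j)
    have "Suc ((a + j) mod g) mod g = (a + Suc j) mod g" by (simp add: mod_Suc_eq)
    then show ?case using succ[OF Suc] by simp
  qed
  have all: "b \<in> set ws" if "b < g" for b
  proof -
    have "(a + (g - a + b)) mod g = b" using small[OF a] that by simp
    then show ?thesis using iter[of "g - a + b"] by simp
  qed
  show ?thesis
  proof
    show "cycle_edges [0..<g] \<subseteq> cycle_edges ws"
      unfolding cycle_edges_upt using succ all by auto
    show "cycle_edges ws \<subseteq> cycle_edges [0..<g]"
    proof
      fix e assume "e \<in> cycle_edges ws"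
      then obtain i where i: "i < length ws" and e: "e = {ws ! i, ws ! (Suc i mod length ws)}"
        by (auto simp: cycle_edges_def)
      define a b where "a = ws ! i" and "b = ws ! (Suc i mod length ws)"
      have "Suc i mod length ws < length ws" using i by (intro mod_less_divisor) auto
      then have lt: "a < g" "b < g" using i small nth_mem by (auto simp: a_def b_def)
      have "(a, b) \<in> parcs T" using ws i by (auto simp: cycle_list_def a_def b_def)
      from adj[OF lt this] show "e \<in> cycle_edges [0..<g]"
        using lt unfolding cycle_edges_upt e a_def[symmetric] b_def[symmetric] by auto
    qed
  qed
qed

lemma graph_cycles_T: "graph_cycles T = {cycle_edges [0..<g]}"
proof -
  have "C = cycle_edges [0..<g]" if "C \<in> cycle_edges ` {ws. cycle_list T ws}" for C
    using that cycle_edges_T_unique by blast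
  moreover have "cycle_edges [0..<g] \<in> cycle_edges ` {ws. cycle_list T ws}"
    using cycle_list_T by blast
  ultimately show ?thesis unfolding graph_cycles_eq[OF pair_graph_T] by blast
qed

lemma T_in_unicyclic_class: "T \<in> unicyclic_class n g (domination_number T)"
proof -
  have "card (cycle_edges [0..<g]) = g" using card_cycle_edges[OF cycle_list_T] by simp
  then show ?thesis
    unfolding unicyclic_class_def unicyclic_def
    by (simp add: graph_cycles_T pair_graph_T connected_T pverts_T)
qed

end

text \<open>One formula for path and leaves: up to \<open>v = n - k\<close> the minimum is
  \<open>v - 1\<close>, and from there on it is the centre \<open>n - k - 1\<close>.\<close>

definition broom_parent :: "nat \<Rightarrow> nat \<Rightarrow> nat \<Rightarrow> nat" where
  "broom_parent n k v = min (v - 1) (n - k - 1)"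

lemma U_graph_eq:
  assumes "3 \<le> g" "g < n" "1 \<le> k" "k \<le> n - g"
  shows "U_graph n k g = rooted_cycle_graph n g (broom_parent n k)"
proof -
  let ?l = "n + 1 - g - k"
  have path: "{(g - 1 + i, g + i) | i. i + 1 < ?l} = (\<lambda>v. (v - 1, v)) ` {g..<n - k}" (is "?A = _")
  proof -
    have "?A = (\<lambda>v. (v - 1, v)) ` (\<lambda>i. g + i) ` {i. i + 1 < ?l}"
      using assms by (auto simp: image_image)
    also have "(\<lambda>i. g + i) ` {i. i + 1 < ?l} = {g..<n - k}"
    proof (intro subset_antisym subsetI)
      fix v assume "v \<in> {g..<n - k}"
      then show "v \<in> (\<lambda>i. g + i) ` {i. i + 1 < ?l}"
        using assms by (intro image_eqI[of _ _ "v - g"]) auto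
    qed (use assms in auto)
    finally show ?thesis .
  qed
  have leaves: "{(n - k - 1, j) | j. n - k \<le> j \<and> j < n} = (\<lambda>v. (n - k - 1, v)) ` {n - k..<n}"
    by auto
  have split: "{g..<n} = {g..<n - k} \<union> {n - k..<n}" using assms by auto
  have "(\<lambda>v. (v, broom_parent n k v)) ` {g..<n - k} = (\<lambda>v. (v, v - 1)) ` {g..<n - k}"
    by (intro image_cong) (auto simp: broom_parent_def)
  moreover have "(\<lambda>v. (v, broom_parent n k v)) ` {n - k..<n} = (\<lambda>v. (v, n - k - 1)) ` {n - k..<n}"
    using assms by (intro image_cong) (auto simp: broom_parent_def)
  moreover have "{(i, (i + 1) mod g) | i. i < g} = (\<lambda>i. (i, Suc i mod g)) ` {..<g}" by auto
  ultimately show ?thesis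
    unfolding U_graph_def rooted_cycle_graph_def Let_def path leaves split image_Un symcl_def
    by (simp add: image_Un image_image Un_ac)
qed

lemma rooted_cycle_broom: "3 \<le> g \<Longrightarrow> g < n \<Longrightarrow> rooted_cycle n g (broom_parent n k)"
  by unfold_locales (auto simp: broom_parent_def)

section \<open>Every unicyclic graph is a cycle with rooted trees\<close>

lemma rtrancl_crosses:
  assumes "(u, v) \<in> R\<^sup>*" "u \<in> S" "v \<notin> S"
  obtains a b where "a \<in> S" "b \<notin> S" "(a, b) \<in> R"
  using assms by (induction rule: rtrancl_induct) auto

text \<open>Greedy growth: while some vertex is missing, connectedness yields an arc leaving the
  listed set, and its head is appended. The earlier neighbours later serve as parents.\<close>

lemma vertex_ordering_exists:
  assumes G: "pair_graph G" and conn: "Digraph_Component.connected (with_proj G)"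
    and vs: "distinct vs" "set vs \<subseteq> pverts G" "vs \<noteq> []"
  obtains ws where "distinct (vs @ ws)" "set (vs @ ws) = pverts G"
    "\<And>i. length vs \<le> i \<Longrightarrow> i < card (pverts G) \<Longrightarrow>
      \<exists>j<i. ((vs @ ws) ! i, (vs @ ws) ! j) \<in> parcs G"
proof -
  interpret pair_graph G by fact
  have ext: "\<exists>ws. length (vs @ ws) = m \<and> distinct (vs @ ws) \<and> set (vs @ ws) \<subseteq> pverts G \<and>
      (\<forall>i. length vs \<le> i \<and> i < m \<longrightarrow> (\<exists>j<i. ((vs @ ws) ! i, (vs @ ws) ! j) \<in> parcs G))"
    if "length vs \<le> m" "m \<le> card (pverts G)" for m
    using that
  proof (induction m rule: dec_induct)
    case base
    show ?case using vs by (intro exI[of _ "[]"]) auto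
  next
    case (step m)
    then obtain ws where ws: "length (vs @ ws) = m" "distinct (vs @ ws)" "set (vs @ ws) \<subseteq> pverts G"
      and par: "\<And>i. length vs \<le> i \<Longrightarrow> i < m \<Longrightarrow> \<exists>j<i. ((vs @ ws) ! i, (vs @ ws) ! j) \<in> parcs G"
      by auto
    have "card (set (vs @ ws)) < card (pverts G)"
      using distinct_card[OF ws(2)] ws(1) step.prems by simp
    then obtain v where v: "v \<in> pverts G" "v \<notin> set (vs @ ws)"
      using ws(3) by (metis less_irrefl subsetI subset_antisym)
    have hd: "hd vs \<in> set (vs @ ws)" using vs by simp
    then have "hd vs \<in> pverts G" using ws(3) by blast
    then have "(hd vs, v) \<in> (parcs G)\<^sup>*"
      using conn v unfolding connected_pair_graph_iff[OF G] by blast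
    from rtrancl_crosses[OF this hd v(2)]
    obtain a b where ab: "a \<in> set (vs @ ws)" "b \<notin> set (vs @ ws)" "(a, b) \<in> parcs G" .
    obtain k where k: "k < m" "a = (vs @ ws) ! k" using ab(1) ws(1) unfolding in_set_conv_nth by auto
    let ?xs = "vs @ (ws @ [b])"
    have nth: "?xs ! i = (vs @ ws) ! i" if "i < m" for i
      using that ws(1) by (metis append.assoc nth_append)
    have nthm: "?xs ! m = b" using ws(1) by (metis append.assoc nth_append_length)
    have "\<exists>j<i. (?xs ! i, ?xs ! j) \<in> parcs G" if i: "length vs \<le> i" "i < Suc m" for i
    proof (cases "i = m")
      case True
      have "(b, a) \<in> parcs G" using pair_graph_sym[OF G ab(3)] .
      then show ?thesis using True k nth[OF k(1)] nthm by auto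
    next
      case False
      then have "i < m" using i by simp
      with par[OF i(1) this] show ?thesis using nth by (metis less_trans)
    qed
    moreover have "b \<in> pverts G" using ab(3) by (rule in_arcsD2)
    moreover have "distinct ?xs" "length ?xs = Suc m" "set (vs @ ws) \<subseteq> pverts G"
      using ws ab(2) by auto
    ultimately show ?case by (intro exI[of _ "ws @ [b]"]) auto
  qed
  have le: "length vs \<le> card (pverts G)"
    using card_mono[OF pair_finite_verts vs(2)] distinct_card[OF vs(1)] by simp
  from ext[OF le order_refl] obtain ws where ws: "length (vs @ ws) = card (pverts G)"
    "distinct (vs @ ws)" "set (vs @ ws) \<subseteq> pverts G"
    and par: "\<forall>i. length vs \<le> i \<and> i < card (pverts G) \<longrightarrow>
      (\<exists>j<i. ((vs @ ws) ! i, (vs @ ws) ! j) \<in> parcs G)"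
    by (elim exE conjE)
  have "set (vs @ ws) = pverts G"
    using ws(1) distinct_card[OF ws(2)] by (intro card_subset_eq pair_finite_verts ws(3)) simp
  then show thesis using that[OF ws(2)] par by simp
qed

text \<open>The ordering grown from the cycle supplies the parents; uniqueness of the cycle then
  excludes any further edge. The last conclusion lets the caller decide which cycle vertex receives
  which number.\<close>

lemma unicyclic_imp_rooted_cycle:
  assumes uni: "unicyclic G" and vs: "cycle_list G vs"
  obtains h p where "rooted_cycle (card (pverts G)) (length vs) p"
    "bij_betw h {..<card (pverts G)} (pverts G)"
    "parcs G = map_prod h h ` parcs (rooted_cycle_graph (card (pverts G)) (length vs) p)"
    "\<And>i. i < length vs \<Longrightarrow> h i = vs ! i"
proof -
  have G: "pair_graph G" and conn: "Digraph_Component.connected (with_proj G)"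
    and uniq: "\<And>C D. C \<in> graph_cycles G \<Longrightarrow> D \<in> graph_cycles G \<Longrightarrow> C = D"
    using uni by (auto simp: unicyclic_def)
  interpret pair_graph G by fact
  define n g where "n = card (pverts G)" and "g = length vs"
  have g: "3 \<le> g" and dist: "distinct vs"
    and arc: "\<And>i. i < g \<Longrightarrow> (vs ! i, vs ! (Suc i mod g)) \<in> parcs G"
    using vs by (auto simp: cycle_list_def g_def)
  have sub: "set vs \<subseteq> pverts G"
  proof
    fix v assume "v \<in> set vs"
    then obtain i where "i < g" "v = vs ! i" by (auto simp: in_set_conv_nth g_def)
    then show "v \<in> pverts G" using arc[of i] by (auto dest: in_arcsD1)
  qed
  have "vs \<noteq> []" using g by (auto simp: g_def)
  from vertex_ordering_exists[OF G conn dist sub this]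
  obtain ws where ws: "distinct (vs @ ws)" "set (vs @ ws) = pverts G"
    and par: "\<And>i. g \<le> i \<Longrightarrow> i < n \<Longrightarrow> \<exists>j<i. ((vs @ ws) ! i, (vs @ ws) ! j) \<in> parcs G"
    unfolding g_def n_def by metis
  define h where "h = (!) (vs @ ws)"
  define p where "p i = (SOME j. j < i \<and> (h i, h j) \<in> parcs G)" for i
  have len: "length (vs @ ws) = n" using distinct_card[OF ws(1)] ws(2) by (simp add: n_def)
  have p: "p i < i" "(h i, h (p i)) \<in> parcs G" if "g \<le> i" "i < n" for i
    using someI_ex[OF par[OF that], folded h_def] unfolding p_def by auto
  have gn: "g \<le> n" using len by (simp add: g_def)
  interpret R: rooted_cycle n g p by unfold_locales (use g gn p in auto)
  have bij: "bij_betw h {..<n} (pverts G)"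
    unfolding h_def using bij_betw_nth[OF ws(1)] len ws(2) by simp
  have inj: "h a = h b \<longleftrightarrow> a = b" if "a < n" "b < n" for a b
    using bij that by (auto simp: bij_betw_def inj_on_def)
  have h_vs: "h i = vs ! i" if "i < g" for i using that by (simp add: h_def nth_append g_def)
  define H where "H = map_prod h h ` parcs R.T"
  have H_sub: "H \<subseteq> parcs G"
  proof
    fix e assume "e \<in> H"
    then obtain a b where e: "e = (h a, h b)" and ab: "(a, b) \<in> parcs R.T" by (auto simp: H_def)
    have cyc: "(h i, h (Suc i mod g)) \<in> parcs G" if "i < g" for i
      using arc[OF that] that h_vs R.Suc_mod_less by simp
    from ab show "e \<in> parcs G"
      unfolding R.parcs_T_iff e using cyc p(2) pair_graph_sym[OF G] by auto
  qed
  have H_sym: "(b, a) \<in> H" if "(a, b) \<in> H" for a b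
    using that pair_graph_sym[OF R.pair_graph_T] by (auto simp: H_def)
  have H_reach: "(h a, h b) \<in> H\<^sup>*" if "a < n" "b < n" for a b
    using R.reach[OF that]
  proof (induction rule: rtrancl_induct)
    case (step b c)
    then have "(h b, h c) \<in> H" by (auto simp: H_def intro!: rev_image_eqI)
    with step.IH show ?case by (rule rtrancl_into_rtrancl)
  qed simp
  have "parcs G \<subseteq> H"
  proof (rule ccontr)
    \<comment> \<open>A path in \<open>H\<close> from \<open>y\<close> to \<open>x\<close> has at
      least three vertices, since \<open>(y, x)\<close> is not in \<open>H\<close>, so the arc
      \<open>(x, y)\<close> closes it to a cycle. Its edges must be those of \<open>vs\<close>,
      which all come from \<open>H\<close>, and hence so does \<open>(x, y)\<close>.\<close>
    assume "\<not> parcs G \<subseteq> H"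
    then obtain x y where xy: "(x, y) \<in> parcs G" "(x, y) \<notin> H" by auto
    have ne: "x \<noteq> y" using pair_no_loops[OF xy(1)] by simp
    have "x \<in> h ` {..<n}" "y \<in> h ` {..<n}"
      using xy(1) bij by (auto simp: bij_betw_def dest: in_arcsD1 in_arcsD2)
    then have "(y, x) \<in> H\<^sup>*" using H_reach by auto
    then obtain xs where xs: "xs \<noteq> []" "hd xs = y" "last xs = x" "distinct xs"
      and step: "\<And>i. Suc i < length xs \<Longrightarrow> (xs ! i, xs ! Suc i) \<in> H"
      by (rule rtrancl_imp_distinct_path) blast
    define m where "m = length xs"
    have nth: "xs ! 0 = y" "xs ! (m - 1) = x"
      using xs by (auto simp: hd_conv_nth last_conv_nth m_def)
    have "m \<noteq> 0" using xs(1) by (simp add: m_def)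
    moreover have "m \<noteq> 1" using nth ne by auto
    moreover have "m \<noteq> 2"
    proof
      assume "m = 2"
      then have "(y, x) \<in> H" using step[of 0] nth by (simp add: m_def)
      then show False using H_sym xy(2) by blast
    qed
    ultimately have m3: "3 \<le> m" by simp
    have "(xs ! i, xs ! (Suc i mod m)) \<in> parcs G" if "i < m" for i
    proof (cases "Suc i < m")
      case True
      then show ?thesis using step H_sub by (auto simp: m_def)
    next
      case False
      then have "i = m - 1" "Suc i mod m = 0" using that by (auto simp: mod_Suc)
      then show ?thesis using nth xy(1) by simp
    qed
    then have xsc: "cycle_list G xs" using m3 xs(4) by (simp add: cycle_list_def m_def)
    have "{xs ! (m - 1), xs ! (Suc (m - 1) mod m)} \<in> cycle_edges xs"
      using m3 unfolding cycle_edges_def m_def by (intro imageI) auto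
    then have "{x, y} \<in> cycle_edges xs" using nth m3 by simp
    moreover have "cycle_edges xs = cycle_edges vs"
      using uniq xsc vs unfolding graph_cycles_eq[OF G] by blast
    ultimately obtain i where i: "i < g" "{x, y} = {vs ! i, vs ! (Suc i mod g)}"
      by (auto simp: cycle_edges_def g_def)
    have "(i, Suc i mod g) \<in> parcs R.T" using i R.parcs_T_iff by simp
    then have "(h i, h (Suc i mod g)) \<in> H" unfolding H_def by (auto intro!: rev_image_eqI)
    then have "(vs ! i, vs ! (Suc i mod g)) \<in> H" using i h_vs R.Suc_mod_less by simp
    then have "(x, y) \<in> H" using i(2) H_sym by (auto simp: doubleton_eq_iff)
    with xy(2) show False by simp
  qed
  with H_sub have "parcs G = H" by simp
  then show thesis
    using that[of p h] R.rooted_cycle_axioms bij h_vs unfolding H_def n_def g_def by simp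
qed


subsection \<open>Eigenvectors of a cycle with rooted trees\<close>

context rooted_cycle
begin

text \<open>For a vertex \<open>v\<close> of the graph, \<open>card (anc v)\<close> is the distance
  from the cycle. The guard \<open>v < n\<close> is what \<open>parent_less\<close> requires for
  termination.\<close>

function anc :: "nat \<Rightarrow> nat set" where
  "anc v = (if g \<le> v \<and> v < n then insert v (anc (p v)) else {})"
  by auto
termination by (relation "measure id") (auto intro: parent_less)

function root :: "nat \<Rightarrow> nat" where
  "root v = (if g \<le> v \<and> v < n then root (p v) else v)"
  by auto
termination by (relation "measure id") (auto intro: parent_less)

declare anc.simps [simp del] root.simps [simp del]

lemma anc_eq_empty: "\<not> (g \<le> v \<and> v < n) \<Longrightarrow> anc v = {}"
  by (subst anc.simps) (rule if_not_P)

lemma anc_cycle [simp]: "v < g \<Longrightarrow> anc v = {}"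
  by (rule anc_eq_empty) simp

lemma anc_tail: "g \<le> v \<Longrightarrow> v < n \<Longrightarrow> anc v = insert v (anc (p v))"
  by (subst anc.simps) simp

lemma root_cycle [simp]: "v < g \<Longrightarrow> root v = v"
  by (subst root.simps) simp

lemma root_tail: "g \<le> v \<Longrightarrow> v < n \<Longrightarrow> root v = root (p v)"
  by (subst root.simps) simp

lemma anc_subset: "anc v \<subseteq> {g..v}"
proof (induction v rule: less_induct)
  case (less v)
  show ?case
  proof (cases "g \<le> v \<and> v < n")
    case True
    then have "anc (p v) \<subseteq> {g..p v}" using less parent_less by simp
    then show ?thesis using True parent_less[of v] by (auto simp: anc_tail)
  qed (simp add: anc_eq_empty)
qed

lemma finite_anc [simp]: "finite (anc v)"
  using anc_subset by (rule finite_subset) simp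

lemma not_in_anc_parent: "g \<le> v \<Longrightarrow> v < n \<Longrightarrow> v \<notin> anc (p v)"
  using anc_subset[of "p v"] parent_less[of v] by auto

lemma card_anc_tail: "g \<le> v \<Longrightarrow> v < n \<Longrightarrow> card (anc v) = Suc (card (anc (p v)))"
  by (simp add: anc_tail not_in_anc_parent)

lemma self_in_anc: "g \<le> v \<Longrightarrow> v < n \<Longrightarrow> v \<in> anc v"
  by (simp add: anc_tail)

lemma parent_lt_n: "g \<le> v \<Longrightarrow> v < n \<Longrightarrow> p v < n"
  using parent_less[of v] by simp

lemma root_less: "v < n \<Longrightarrow> root v < g"
proof (induction v rule: less_induct)
  case (less v)
  then show ?case using parent_less[of v] parent_lt_n[of v]
    by (cases "v < g") (auto simp: root_tail)
qed

text \<open>The sum telescopes along the path from \<open>v\<close> to its root: increments along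
  tree edges recover a function from its values on the cycle.\<close>

lemma sum_anc:
  fixes f :: "nat \<Rightarrow> real"
  assumes "v < n"
  shows "(\<Sum>a\<in>anc v. f a - f (p a)) = f v - f (root v)"
  using assms
proof (induction v rule: less_induct)
  case (less v)
  show ?case
  proof (cases "v < g")
    case False
    then have v: "g \<le> v" "v < n" using less by auto
    then show ?thesis
      using less.IH[OF parent_less[OF v] parent_lt_n[OF v]] not_in_anc_parent[OF v]
      by (simp add: anc_tail root_tail)
  qed simp
qed

definition sg :: "nat \<Rightarrow> real" where
  "sg v = (-1) ^ card (anc v)"

lemma sg_cycle [simp]: "v < g \<Longrightarrow> sg v = 1"
  by (simp add: sg_def)

lemma sg_tail: "g \<le> v \<Longrightarrow> v < n \<Longrightarrow> sg v = - sg (p v)"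
  by (simp add: sg_def card_anc_tail)

lemma sg_sq [simp]: "sg v * sg v = 1" "sg v * (sg v * a) = a" "\<bar>sg v\<bar> = 1"
  by (simp_all add: sg_def flip: power_add mult.assoc)

definition cycle_form :: "(nat \<Rightarrow> real) \<Rightarrow> (nat \<Rightarrow> real) \<Rightarrow> real" where
  "cycle_form x y = (\<Sum>i<g. (x i + x (Suc i mod g)) * (y i + y (Suc i mod g)))"

lemma edge_form_T:
  "edge_form T x y = cycle_form x y + (\<Sum>v=g..<n. (x v + x (p v)) * (y v + y (p v)))"
proof -
  define f where "f = (\<lambda>(u, v). (x u + x v) * (y u + y v))"
  define C D where "C = (\<lambda>i. (i, Suc i mod g)) ` {..<g}" and "D = (\<lambda>v. (v, p v)) ` {g..<n}"
  let ?s = "\<lambda>(a, b). (b, a) :: nat \<times> nat"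
  have CD: "finite C" "finite D" "C \<inter> D = {}" by (auto simp: C_def D_def)
  \<comment> \<open>No arc listed here is the reverse of another: parents decrease, and on the cycle
    this uses \<open>3 \<le> g\<close>. So every edge is counted exactly twice, which cancels the
    halving.\<close>
  have "(C \<union> D) \<inter> ?s ` (C \<union> D) = {}"
  proof -
    have False if "(a, b) \<in> C \<union> D" "(b, a) \<in> C \<union> D" for a b
      using that g_ge_3 parent_less[of a] parent_less[of b] Suc_mod_less
      by (auto simp: C_def D_def mod_Suc split: if_splits)
    then show ?thesis by auto
  qed
  then have "sum f (parcs T) = sum f (C \<union> D) + sum f (?s ` (C \<union> D))"
    using CD unfolding rooted_cycle_graph_def symcl_def C_def[symmetric] D_def[symmetric]
    by (simp add: sum.union_disjoint)
  also have "sum f (?s ` (C \<union> D)) = sum f (C \<union> D)"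
    by (subst sum.reindex) (auto simp: inj_on_def f_def add.commute intro!: sum.cong)
  also have "sum f (C \<union> D) = sum f C + sum f D" using CD by (simp add: sum.union_disjoint)
  also have "sum f C = cycle_form x y"
    unfolding C_def cycle_form_def by (subst sum.reindex) (auto simp: inj_on_def f_def)
  also have "sum f D = (\<Sum>v=g..<n. (x v + x (p v)) * (y v + y (p v)))"
    unfolding D_def by (subst sum.reindex) (auto simp: inj_on_def f_def)
  finally show ?thesis unfolding edge_form_def f_def by simp
qed

lemma vertex_form_T: "vertex_form T x y = (\<Sum>i<g. x i * y i) + (\<Sum>v=g..<n. x v * y v)"
  unfolding vertex_form_def pverts_T
  using sum.atLeastLessThan_concat[of 0 g n "\<lambda>v. x v * y v"] g_le_n by (simp add: atLeast0LessThan)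

lemma cycle_form_cong: "(\<And>i. i < g \<Longrightarrow> x i = x' i) \<Longrightarrow> (\<And>i. i < g \<Longrightarrow> y i = y' i) \<Longrightarrow>
    cycle_form x y = cycle_form x' y'"
  unfolding cycle_form_def using Suc_mod_less by (intro sum.cong) auto

lemma cycle_form_0: "cycle_form x (\<lambda>_. 0) = 0"
  by (simp add: cycle_form_def)

lemma sum_ancestor_swap:
  fixes f :: "nat \<Rightarrow> real"
  shows "(\<Sum>v=g..<n. \<Sum>u | u \<in> {g..<n} \<and> v \<in> anc u. f u * h v) = (\<Sum>u=g..<n. f u * sum h (anc u))"
proof -
  have "(\<Sum>v=g..<n. \<Sum>u | u \<in> {g..<n} \<and> v \<in> anc u. f u * h v)
      = (\<Sum>u=g..<n. \<Sum>v | v \<in> {g..<n} \<and> v \<in> anc u. f u * h v)"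
    by (rule sum.swap_restrict) auto
  also have "\<dots> = (\<Sum>u=g..<n. f u * sum h (anc u))"
  proof (rule sum.cong[OF refl])
    fix u assume "u \<in> {g..<n}"
    then have "{v \<in> {g..<n}. v \<in> anc u} = anc u" using anc_subset[of u] by auto
    then show "(\<Sum>v | v \<in> {g..<n} \<and> v \<in> anc u. f u * h v) = f u * sum h (anc u)"
      by (simp add: sum_distrib_left)
  qed
  finally show ?thesis .
qed

lemma sum_common_ancestors:
  fixes f :: "nat \<Rightarrow> real"
  assumes "v < n"
  shows "(\<Sum>a\<in>anc v. \<Sum>u | u \<in> {g..<n} \<and> a \<in> anc u. f u)
    = (\<Sum>u=g..<n. real (card (anc u \<inter> anc v)) * f u)"
proof -
  have "(\<Sum>a\<in>anc v. \<Sum>u | u \<in> {g..<n} \<and> a \<in> anc u. f u)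
      = (\<Sum>u=g..<n. \<Sum>a | a \<in> anc v \<and> a \<in> anc u. f u)"
    by (rule sum.swap_restrict) auto
  also have "\<dots> = (\<Sum>u=g..<n. real (card (anc u \<inter> anc v)) * f u)"
    by (rule sum.cong) (auto simp: Int_def conj_commute)
  finally show ?thesis .
qed

text \<open>The solution of the discrete Poisson equation on the trees with source
  \<open>\<mu> * z\<close> and boundary value \<open>M\<close> on the whole cycle.\<close>

definition lift :: "real \<Rightarrow> real \<Rightarrow> (nat \<Rightarrow> real) \<Rightarrow> nat \<Rightarrow> real" where
  "lift M \<mu> z v = M + \<mu> * (\<Sum>u=g..<n. real (card (anc u \<inter> anc v)) * z u)"

lemma lift_cycle: "v < g \<Longrightarrow> lift M \<mu> z v = M"
  by (simp add: lift_def)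

text \<open>Moving from \<open>p v\<close> to \<open>v\<close> adds one common ancestor exactly for
  the \<open>u\<close> in the subtree below \<open>v\<close>, so the increment is
  \<open>\<mu>\<close> times the mass of \<open>z\<close> there.\<close>

lemma lift_diff:
  assumes v: "g \<le> v" "v < n"
  shows "lift M \<mu> z v - lift M \<mu> z (p v) = \<mu> * (\<Sum>u | u \<in> {g..<n} \<and> v \<in> anc u. z u)"
proof -
  have "real (card (anc u \<inter> anc v)) * z u - real (card (anc u \<inter> anc (p v))) * z u
      = (if v \<in> anc u then z u else 0)" for u
    using not_in_anc_parent[OF v] by (auto simp: anc_tail[OF v] algebra_simps)
  then have "lift M \<mu> z v - lift M \<mu> z (p v) = \<mu> * (\<Sum>u=g..<n. if v \<in> anc u then z u else 0)"
    by (simp add: lift_def flip: right_diff_distrib sum_subtractf)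
  also have "(\<Sum>u=g..<n. if v \<in> anc u then z u else 0) = (\<Sum>u | u \<in> {g..<n} \<and> v \<in> anc u. z u)"
    by (rule sum.inter_filter[symmetric]) simp
  finally show ?thesis .
qed

text \<open>A discrete Green identity: one factor of each square is replaced by the mass below
  \<open>v\<close>, the sums over \<open>u\<close> and \<open>v\<close> are exchanged, and the other
  factor telescopes along \<open>anc u\<close>.\<close>

lemma sum_lift_diff_sq:
  "(\<Sum>v=g..<n. (lift M \<mu> z v - lift M \<mu> z (p v))\<^sup>2) = \<mu> * (\<Sum>u=g..<n. z u * (lift M \<mu> z u - M))"
proof -
  let ?d = "\<lambda>v. lift M \<mu> z v - lift M \<mu> z (p v)"
  have "(\<Sum>v=g..<n. (?d v)\<^sup>2) = (\<Sum>v=g..<n. \<mu> * (\<Sum>u | u \<in> {g..<n} \<and> v \<in> anc u. z u * ?d v))"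
  proof (rule sum.cong[OF refl])
    fix v assume "v \<in> {g..<n}"
    then have d: "?d v = \<mu> * (\<Sum>u | u \<in> {g..<n} \<and> v \<in> anc u. z u)" using lift_diff by simp
    have "(?d v)\<^sup>2 = (\<mu> * (\<Sum>u | u \<in> {g..<n} \<and> v \<in> anc u. z u)) * ?d v"
      unfolding d[symmetric] by (simp add: power2_eq_square)
    then show "(?d v)\<^sup>2 = \<mu> * (\<Sum>u | u \<in> {g..<n} \<and> v \<in> anc u. z u * ?d v)"
      by (simp add: sum_distrib_right mult.assoc)
  qed
  also have "\<dots> = \<mu> * (\<Sum>u=g..<n. z u * sum ?d (anc u))"
    by (simp only: sum_distrib_left[symmetric] sum_ancestor_swap)
  also have "(\<Sum>u=g..<n. z u * sum ?d (anc u)) = (\<Sum>u=g..<n. z u * (lift M \<mu> z u - M))"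
    by (rule sum.cong) (auto simp: sum_anc lift_cycle root_less)
  finally show ?thesis .
qed

end

section \<open>Test functions adapted to the trees\<close>

locale rooted_cycle_eigenvector = rooted_cycle +
  fixes x :: "nat \<Rightarrow> real" and \<mu> :: real
  assumes eigenvector: "\<And>y. edge_form T x y = \<mu> * vertex_form T x y"
begin

text \<open>On the trees the sign change turns the signless Laplacian into the Laplacian.\<close>
definition w :: "nat \<Rightarrow> real" where
  "w v = sg v * x v"

lemma w_cycle [simp]: "v < g \<Longrightarrow> w v = x v"
  by (simp add: w_def)

lemma abs_w [simp]: "\<bar>w v\<bar> = \<bar>x v\<bar>"
  by (simp add: w_def abs_mult)

lemma edge_sum_eq: "g \<le> v \<Longrightarrow> v < n \<Longrightarrow> x v + x (p v) = sg v * (w v - w (p v))"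
  by (simp add: w_def sg_tail right_diff_distrib)

lemma flow:
  assumes v: "g \<le> v" "v < n"
  shows "w v - w (p v) = \<mu> * (\<Sum>u | u \<in> {g..<n} \<and> v \<in> anc u. w u)"
proof -
  \<comment> \<open>Supported on the subtree below \<open>v\<close> with alternating signs, so that
    \<open>y\<close> cancels on every edge except the one from \<open>v\<close> to its
    parent.\<close>
  define y where "y u = (if v \<in> anc u then sg u else 0)" for u
  have "cycle_form x y = 0"
    using cycle_form_cong[of x x y "\<lambda>_. 0"] by (simp add: cycle_form_0 y_def)
  moreover have "(\<Sum>u=g..<n. (x u + x (p u)) * (y u + y (p u)))
      = (\<Sum>u=g..<n. if u = v then w v - w (p v) else 0)"
  proof (rule sum.cong[OF refl])
    fix u assume "u \<in> {g..<n}"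
    then have u: "g \<le> u" "u < n" by auto
    show "(x u + x (p u)) * (y u + y (p u)) = (if u = v then w v - w (p v) else 0)"
    proof (cases "u = v")
      case True
      then have "y u = sg v" "y (p u) = 0"
        using not_in_anc_parent[OF v] self_in_anc[OF v] by (auto simp: y_def)
      then show ?thesis using True edge_sum_eq[OF v] by (simp add: mult.commute)
    next
      case False
      then have "y u + y (p u) = 0" using u by (simp add: y_def anc_tail sg_tail)
      then show ?thesis using False by simp
    qed
  qed
  moreover have "vertex_form T x y = (\<Sum>u=g..<n. if v \<in> anc u then w u else 0)"
    unfolding vertex_form_T by (simp add: y_def) (rule sum.cong; simp add: w_def mult.commute)
  moreover have "(\<Sum>u=g..<n. if v \<in> anc u then w u else 0) = (\<Sum>u | u \<in> {g..<n} \<and> v \<in> anc u. w u)"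
    by (rule sum.inter_filter[symmetric]) simp
  ultimately show ?thesis using eigenvector[of y] v by (simp add: edge_form_T)
qed

text \<open>The increments from \<open>flow\<close>, summed along the path to the root, count each
  \<open>w u\<close> once for every common ancestor of \<open>u\<close> and
  \<open>v\<close>.\<close>

lemma w_eq:
  assumes "v < n"
  shows "w v = w (root v) + \<mu> * (\<Sum>u=g..<n. real (card (anc u \<inter> anc v)) * w u)"
proof -
  have "w v - w (root v) = (\<Sum>a\<in>anc v. w a - w (p a))" using sum_anc[OF assms] by simp
  also have "\<dots> = (\<Sum>a\<in>anc v. \<mu> * (\<Sum>u | u \<in> {g..<n} \<and> a \<in> anc u. w u))"
    using anc_subset[of v] assms by (intro sum.cong flow) auto
  also have "\<dots> = \<mu> * (\<Sum>u=g..<n. real (card (anc u \<inter> anc v)) * w u)"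
    by (simp only: sum_distrib_left[symmetric] sum_common_ancestors[OF assms])
  finally show ?thesis by simp
qed

lemma abs_le_lift:
  assumes "0 \<le> \<mu>" "v < n"
  shows "\<bar>x v\<bar> \<le> lift \<bar>x (root v)\<bar> \<mu> (\<lambda>u. \<bar>x u\<bar>) v"
proof -
  have "\<bar>w v\<bar> \<le> \<bar>w (root v)\<bar> + \<bar>\<mu> * (\<Sum>u=g..<n. real (card (anc u \<inter> anc v)) * w u)\<bar>"
    unfolding w_eq[OF assms(2)] by (rule abs_triangle_ineq)
  also have "\<bar>\<mu> * (\<Sum>u=g..<n. real (card (anc u \<inter> anc v)) * w u)\<bar>
      \<le> \<mu> * (\<Sum>u=g..<n. real (card (anc u \<inter> anc v)) * \<bar>x u\<bar>)"
    unfolding abs_mult abs_of_nonneg[OF assms(1)]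
    by (intro mult_left_mono assms(1) order_trans[OF sum_abs]) (simp add: abs_mult)
  finally show ?thesis by (simp add: lift_def)
qed

text \<open>The test function takes on each tree the value at its root, up to the alternating sign,
  so all tree edges drop out.\<close>

lemma cycle_form_eigenvector:
  "cycle_form x x = \<mu> * ((\<Sum>i<g. x i * x i) + (\<Sum>v=g..<n. w v * w (root v)))"
proof -
  define y where "y v = sg v * w (root v)" for v
  have "cycle_form x y = cycle_form x x"
    by (rule cycle_form_cong) (auto simp: y_def)
  moreover have "(\<Sum>v=g..<n. (x v + x (p v)) * (y v + y (p v))) = 0"
    by (rule sum.neutral) (auto simp: y_def sg_tail root_tail)
  moreover have "vertex_form T x y = (\<Sum>i<g. x i * x i) + (\<Sum>v=g..<n. w v * w (root v))"
    unfolding vertex_form_T by (simp add: y_def w_def mult_ac)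
  ultimately show ?thesis using eigenvector[of y] by (simp add: edge_form_T)
qed

text \<open>The eigenvalue equations at \<open>c\<close> and on the tree hanging there are summed
  with signs: tree edges cancel, and only the cycle edges at \<open>c\<close> remain.\<close>

lemma cycle_form_unit:
  assumes "c < g"
  shows "cycle_form x (\<lambda>u. if u = c then 1 else 0)
    = \<mu> * (x c + (\<Sum>v | v \<in> {g..<n} \<and> root v = c. w v))"
proof -
  define y where "y v = (if root v = c then sg v else 0)" for v
  have "cycle_form x y = cycle_form x (\<lambda>u. if u = c then 1 else 0)"
    by (rule cycle_form_cong) (auto simp: y_def)
  moreover have "(\<Sum>v=g..<n. (x v + x (p v)) * (y v + y (p v))) = 0"
    by (rule sum.neutral) (auto simp: y_def sg_tail root_tail)
  moreover have "(\<Sum>i<g. x i * y i) = (\<Sum>i<g. if i = c then x c else 0)"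
    by (rule sum.cong) (auto simp: y_def)
  moreover have "(\<Sum>v=g..<n. x v * y v) = (\<Sum>v=g..<n. if root v = c then w v else 0)"
    by (rule sum.cong) (auto simp: y_def w_def)
  moreover have "\<dots> = (\<Sum>v | v \<in> {g..<n} \<and> root v = c. w v)"
    by (rule sum.inter_filter[symmetric]) simp
  ultimately show ?thesis
    using eigenvector[of y] assms by (simp add: edge_form_T vertex_form_T)
qed

lemma eigenvalue_nonneg:
  assumes "v < n" "x v \<noteq> 0"
  shows "0 \<le> \<mu>"
proof -
  have "0 < vertex_form T x x" using assms by (intro vertex_form_pos[of _ v]) (auto simp: pverts_T)
  then show ?thesis
    using edge_form_nonneg[of T x] eigenvector[of x] by (simp add: zero_le_mult_iff)
qed

text \<open>A zero eigenvalue makes the edge sums on the cycle vanish, so \<open>x\<close>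
  alternates in sign around it; odd length forces \<open>x = 0\<close> there, and \<open>w\<close>
  is constant along each tree.\<close>

lemma eigenvalue_pos:
  assumes "odd g" "v < n" "x v \<noteq> 0"
  shows "0 < \<mu>"
proof (rule ccontr)
  assume "\<not> 0 < \<mu>"
  then have mu: "\<mu> = 0" using eigenvalue_nonneg[OF assms(2,3)] by simp
  have "(\<Sum>i<g. (x i + x (Suc i mod g))\<^sup>2) = 0"
    using cycle_form_eigenvector mu by (simp add: cycle_form_def power2_eq_square)
  then have "x i + x (Suc i mod g) = 0" if "i < g" for i
    using that by (subst (asm) sum_nonneg_eq_0_iff) auto
  then have alt: "x (Suc i mod g) = - x i" if "i < g" for i
    using that by (metis add.commute eq_neg_iff_add_eq_0)
  have pow: "x i = (-1) ^ i * x 0" if "i < g" for i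
    using that
  proof (induction i)
    case (Suc i)
    then show ?case using alt[of i] by simp
  qed simp
  have "x (Suc (g - 1) mod g) = - x (g - 1)" using alt[of "g - 1"] g_ge_3 by simp
  then have "x 0 = - ((-1) ^ (g - 1) * x 0)" using pow[of "g - 1"] g_ge_3 by simp
  then have "x 0 = 0" using assms(1) by simp
  then have "x (root v) = 0" using pow[OF root_less[OF assms(2)]] by simp
  then have "w v = 0" using w_eq[OF assms(2)] root_less[OF assms(2)] mu by simp
  then show False using assms(3) abs_w[of v] by simp
qed

end


subsection \<open>The broom minimizes the least eigenvalue\<close>

locale broom_cycle =
  fixes n g k :: nat
  assumes g3: "3 \<le> g" and gn: "g < n" and k1: "1 \<le> k" and kn: "k \<le> n - g"
begin

sublocale rooted_cycle n g "broom_parent n k"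
  by (rule rooted_cycle_broom) (rule g3, rule gn)

lemma anc_broom:
  assumes "g \<le> v" "v < n"
  shows "anc v = (if v < n - k then {g..v} else insert v {g..<n - k})"
  using assms
proof (induction v rule: less_induct)
  case (less v)
  define b where "b = broom_parent n k v"
  have b: "b = min (v - 1) (n - k - 1)" by (simp add: b_def broom_parent_def)
  have anc: "anc v = insert v (anc b)" unfolding b_def by (rule anc_tail[OF less.prems])
  have "anc b = {g..b}"
  proof (cases "b < g")
    case False
    moreover have "b < v" "b < n - k" using less.prems g3 k1 kn by (auto simp: b)
    ultimately show ?thesis using less by simp
  qed simp
  moreover have "insert v {g..v - 1} = {g..v}" using less.prems by auto
  moreover have "{g..n - k - 1} = {g..<n - k}"
  proof -
    have "Suc (n - k - 1) = n - k" using g3 kn gn by arith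
    then show ?thesis by (metis atLeastLessThanSuc_atLeastAtMost)
  qed
  moreover have "b = (if v < n - k then v - 1 else n - k - 1)" using b by auto
  ultimately show ?case unfolding anc by simp
qed

lemma root_broom: "g \<le> v \<Longrightarrow> v < n \<Longrightarrow> root v = g - 1"
proof (induction v rule: less_induct)
  case (less v)
  have lt: "broom_parent n k v < v" using less parent_less by simp
  have "root (broom_parent n k v) = g - 1"
  proof (cases "broom_parent n k v < g")
    case True
    then have "broom_parent n k v = g - 1" using less.prems kn k1 by (auto simp: broom_parent_def)
    then show ?thesis using g3 by simp
  next
    case False
    then show ?thesis using less.IH[OF lt] lt less.prems by simp
  qed
  then show ?case using root_tail less.prems by simp
qed

end

text \<open>
  The broom dominates every other rooted forest of the same depth entrywise:
  \<open>card (anc u \<inter> anc v)\<close> is the Green function of the forest with the cycle grounded.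
\<close>
lemma card_common_anc_le_broom:
  assumes "rooted_cycle n g p" "broom_cycle n g k"
    and depth: "\<And>v. g \<le> v \<Longrightarrow> v < n \<Longrightarrow> card (rooted_cycle.anc n g p v) \<le> n + 1 - g - k"
    and u: "g \<le> u" "u < n" and v: "g \<le> v" "v < n"
  shows "card (rooted_cycle.anc n g p u \<inter> rooted_cycle.anc n g p v)
    \<le> card (rooted_cycle.anc n g (broom_parent n k) u \<inter> rooted_cycle.anc n g (broom_parent n k) v)"
proof -
  interpret R: rooted_cycle n g p by fact
  interpret B: broom_cycle n g k by fact
  have self: "card (R.anc v) \<le> card (B.anc v)" if v: "g \<le> v" "v < n" for v
  proof (cases "v < n - k")
    case True
    have "card (R.anc v) \<le> card {g..v}" by (intro card_mono R.anc_subset) simp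
    then show ?thesis using B.anc_broom[OF v] True by simp
  next
    case False
    then have "card (B.anc v) = n + 1 - g - k" using B.anc_broom[OF v] B.kn B.gn by simp
    then show ?thesis using depth[OF v] by simp
  qed
  \<comment> \<open>If \<open>u\<close> is on the path, the broom attains the bound
    \<open>card {g..u}\<close> that decreasing parents impose on any forest. If \<open>u\<close> is
    a leaf, the broom shares the whole path, one vertex short of the maximal depth, and in the other
    forest \<open>v\<close> is not shared because it is larger than \<open>u\<close>.\<close>
  have less: "card (R.anc u \<inter> R.anc v) \<le> card (B.anc u \<inter> B.anc v)"
    if uv: "u < v" and u: "g \<le> u" and v: "v < n" for u v
  proof (cases "u < n - k")
    case True
    then have "B.anc u \<inter> B.anc v = {g..u}"
      using uv u v B.anc_broom[of u] B.anc_broom[of v] by auto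
    moreover have "card (R.anc u \<inter> R.anc v) \<le> card {g..u}"
      using R.anc_subset[of u] by (intro card_mono) auto
    ultimately show ?thesis by simp
  next
    case False
    then have "B.anc u \<inter> B.anc v = {g..<n - k}"
      using uv u v B.anc_broom[of u] B.anc_broom[of v] by auto
    moreover have "R.anc u \<inter> R.anc v \<subset> R.anc v"
      using R.self_in_anc[of v] R.anc_subset[of u] uv u v by auto
    then have "card (R.anc u \<inter> R.anc v) < card (R.anc v)" by (intro psubset_card_mono) simp
    ultimately show ?thesis using depth[of v] uv u v by simp
  qed
  consider "u = v" | "u < v" | "v < u" by linarith
  then show ?thesis
  proof cases
    case 3
    then show ?thesis using less[of v u] u v by (simp add: Int_commute)
  qed (use self less u v in auto)
qed

text \<open>The eigenvector is transplanted to the broom. The hypothesis \<open>max\<close> makes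
  \<open>g - 1\<close>, where the broom hangs, a vertex of largest absolute value on the
  cycle.\<close>

lemma q_min_broom_le:
  assumes "rooted_cycle_eigenvector n g p x \<mu>" and "broom_cycle n g k" and odd: "odd g"
    and nz: "v0 < n" "x v0 \<noteq> 0"
    and depth: "\<And>v. g \<le> v \<Longrightarrow> v < n \<Longrightarrow> card (rooted_cycle.anc n g p v) \<le> n + 1 - g - k"
    and max: "\<And>i. i < g \<Longrightarrow> \<bar>x i\<bar> \<le> \<bar>x (g - 1)\<bar>"
  defines "U \<equiv> rooted_cycle_graph n g (broom_parent n k)"
  shows "q_min U \<le> \<mu>"
    and "q_min U = \<mu> \<Longrightarrow> g \<le> v \<Longrightarrow> v < n \<Longrightarrow> p v = broom_parent n k v"
proof -
  interpret R: rooted_cycle_eigenvector n g p x \<mu> by fact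
  interpret B: broom_cycle n g k by fact
  have g3: "3 \<le> g" by (rule R.g_ge_3)
  have mu: "0 < \<mu>" by (rule R.eigenvalue_pos[OF odd nz])
  define z where "z v = \<bar>x v\<bar>" for v
  define M where "M = \<bar>x (g - 1)\<bar>"
  \<comment> \<open>The sign of \<open>x (g - 1)\<close>, taken as 1 at zero; it fits the
    nonnegative potential \<open>Y\<close> to the value of \<open>x\<close> at the attaching
    vertex.\<close>
  define \<sigma> :: real where "\<sigma> = (if 0 \<le> x (g - 1) then 1 else -1)"
  have sig: "\<sigma> * \<sigma> = 1" "\<sigma> * M = x (g - 1)" by (auto simp: \<sigma>_def M_def)
  define Y where "Y = B.lift M \<mu> z"
  define y where "y v = (if v < g then x v else \<sigma> * B.sg v * Y v)" for v
  have z0: "0 \<le> z v" for v by (simp add: z_def)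
  have M0: "0 \<le> M" by (simp add: M_def)
  have root_le: "\<bar>x (R.root v)\<bar> \<le> M" if "v < n" for v
    using max R.root_less[OF that] by (simp add: M_def)
  let ?N = "\<lambda>v. (\<Sum>u=g..<n. real (card (R.anc u \<inter> R.anc v)) * z u)"
  let ?N' = "\<lambda>v. (\<Sum>u=g..<n. real (card (B.anc u \<inter> B.anc v)) * z u)"
  have card_le: "card (R.anc u \<inter> R.anc v) \<le> card (B.anc u \<inter> B.anc v)"
    if "g \<le> u" "u < n" "g \<le> v" "v < n" for u v
    using card_common_anc_le_broom[OF R.rooted_cycle_axioms assms(2) depth that] by blast
  have N_le: "?N v \<le> ?N' v" if "g \<le> v" "v < n" for v
    using card_le that z0 by (intro sum_mono mult_right_mono) auto
  have zN: "z v \<le> M + \<mu> * ?N v" if "v < n" for v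
    using R.abs_le_lift[of v] root_le[OF that] that mu by (simp add: z_def R.lift_def)
  have Y_eq: "Y v = M + \<mu> * ?N' v" for v by (simp add: Y_def B.lift_def)
  have zY: "z v \<le> Y v" if "g \<le> v" "v < n" for v
    unfolding Y_eq using mu
    by (intro order_trans[OF zN[OF that(2)]] add_left_mono mult_left_mono N_le that) simp
  have YM: "M \<le> Y v" for v
    unfolding Y_eq using mu z0 by (simp add: sum_nonneg)
  \<comment> \<open>\<open>D1\<close> measures the loss from roots with a value smaller than
    \<open>M\<close> or of the wrong sign, \<open>D2\<close> the weighted excess of the potential
    over \<open>\<bar>x\<bar>\<close>; \<open>\<mu> * (D1 + D2)\<close> is the gap in the Rayleigh
    inequality.\<close>
  define D1 where "D1 = (\<Sum>v=g..<n. M * z v - R.w v * R.w (R.root v))"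
  define D2 where "D2 = (\<Sum>v=g..<n. Y v * (Y v - z v))"
  have D1_nonneg: "0 \<le> M * z v - R.w v * R.w (R.root v)" if "v < n" for v
  proof -
    have "R.w v * R.w (R.root v) \<le> \<bar>R.w v\<bar> * \<bar>R.w (R.root v)\<bar>"
      by (metis abs_ge_self abs_mult)
    also have "\<dots> \<le> z v * M" using root_le[OF that] by (simp add: z_def mult_left_mono)
    finally show ?thesis by (simp add: mult.commute)
  qed
  have D2_nonneg: "0 \<le> Y v * (Y v - z v)" if "g \<le> v" "v < n" for v
    using zY[OF that] YM[of v] M0 by simp
  have D1: "0 \<le> D1" unfolding D1_def by (intro sum_nonneg D1_nonneg) auto
  have D2: "0 \<le> D2" unfolding D2_def by (intro sum_nonneg D2_nonneg) auto
  have tail_edge: "(y v + y (broom_parent n k v)) * (y v + y (broom_parent n k v))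
      = (Y v - Y (broom_parent n k v))\<^sup>2" if v: "g \<le> v" "v < n" for v
  proof -
    \<comment> \<open>The formula for \<open>y\<close> on the broom also holds at the attaching
      vertex \<open>g - 1\<close>, where the potential equals \<open>M\<close>.\<close>
    have "y (broom_parent n k v) = \<sigma> * B.sg (broom_parent n k v) * Y (broom_parent n k v)"
    proof (cases "broom_parent n k v < g")
      case True
      then have "broom_parent n k v = g - 1" using B.root_broom[OF v] B.root_tail[OF v] by simp
      then show ?thesis using g3 sig(2) by (simp add: y_def Y_def B.lift_cycle)
    qed (simp add: y_def)
    moreover have "y v = - (\<sigma> * B.sg (broom_parent n k v) * Y v)"
      using v B.sg_tail[OF v] by (simp add: y_def)
    ultimately have "y v + y (broom_parent n k v)
        = - (\<sigma> * B.sg (broom_parent n k v) * (Y v - Y (broom_parent n k v)))"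
      by (simp add: algebra_simps)
    moreover have "(- (\<sigma> * s * d)) * (- (\<sigma> * s * d)) = d\<^sup>2" if "s * s = 1" for s d
    proof -
      have "(- (\<sigma> * s * d)) * (- (\<sigma> * s * d)) = (\<sigma> * \<sigma>) * (s * s) * (d * d)" by (simp add: mult_ac)
      then show ?thesis by (simp add: sig that power2_eq_square)
    qed
    ultimately show ?thesis by simp
  qed
  have cyc: "B.cycle_form y f = R.cycle_form x f" for f
    unfolding B.cycle_form_def R.cycle_form_def
    using B.Suc_mod_less by (intro sum.cong) (auto simp: y_def)
  have cyc2: "B.cycle_form y y = R.cycle_form x x"
    unfolding cyc unfolding R.cycle_form_def
    using B.Suc_mod_less by (intro sum.cong) (auto simp: y_def)
  have edge: "edge_form U y y = R.cycle_form x x + \<mu> * (\<Sum>v=g..<n. z v * (Y v - M))"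
  proof -
    have "(\<Sum>v=g..<n. (y v + y (broom_parent n k v)) * (y v + y (broom_parent n k v)))
        = (\<Sum>v=g..<n. (Y v - Y (broom_parent n k v))\<^sup>2)"
      by (intro sum.cong tail_edge) auto
    then show ?thesis unfolding U_def B.edge_form_T cyc2 by (simp add: Y_def B.sum_lift_diff_sq)
  qed
  have vert: "vertex_form U y y = (\<Sum>i<g. x i * x i) + (\<Sum>v=g..<n. Y v * Y v)"
  proof -
    have "y v * y v = Y v * Y v" if "g \<le> v" for v
    proof -
      have "y v * y v = (\<sigma> * \<sigma>) * (B.sg v * B.sg v) * (Y v * Y v)"
        using that by (simp add: y_def mult_ac)
      then show ?thesis by (simp add: sig)
    qed
    then have "(\<Sum>v=g..<n. y v * y v) = (\<Sum>v=g..<n. Y v * Y v)" by (intro sum.cong) auto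
    moreover have "(\<Sum>i<g. y i * y i) = (\<Sum>i<g. x i * x i)" by (simp add: y_def)
    ultimately show ?thesis unfolding U_def B.vertex_form_T by simp
  qed
  have diff: "edge_form U y y = \<mu> * vertex_form U y y - \<mu> * (D1 + D2)"
    unfolding edge vert R.cycle_form_eigenvector D1_def D2_def
    by (simp add: algebra_simps sum.distrib sum_subtractf sum_distrib_left)
  have "vertex_form U y y > 0"
  proof (cases "v0 < g")
    case True
    then show ?thesis using nz
      by (intro vertex_form_pos[of _ v0]) (auto simp: U_def B.pverts_T y_def)
  next
    case False
    then have "Y v0 > 0" using zY[of v0] nz by (auto simp: z_def)
    then have "y v0 \<noteq> 0" using False sig by (auto simp: y_def B.sg_def)
    then show ?thesis using nz
      by (intro vertex_form_pos[of _ v0]) (auto simp: U_def B.pverts_T)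
  qed
  note vpos = this
  have U: "pair_graph U" "pverts U \<noteq> {}" "finite (pverts U)"
    using B.pair_graph_T nz by (auto simp: U_def B.pverts_T)
  have q_le: "\<And>f. q_min U * vertex_form U f f \<le> edge_form U f f"
    by (rule q_min_eigenvector[OF U(1,2)]) blast
  have "q_min U * vertex_form U y y \<le> \<mu> * vertex_form U y y"
    using q_le[of y] diff mu D1 D2 by (smt (verit) mult_nonneg_nonneg)
  then show "q_min U \<le> \<mu>" using vpos by simp
  show "p v = broom_parent n k v" if eq: "q_min U = \<mu>" and v: "g \<le> v" "v < n"
  proof -
    have "\<mu> * (D1 + D2) \<le> 0" using q_le[of y] diff eq by simp
    then have "D1 + D2 \<le> 0" using mu by (simp add: mult_le_0_iff)
    then have D0: "D1 = 0" "D2 = 0" using D1 D2 by auto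
    have w0: "R.w v * R.w (R.root v) = M * z v" if "g \<le> v" "v < n" for v
    proof -
      have "\<forall>v\<in>{g..<n}. M * z v - R.w v * R.w (R.root v) = 0"
        using D0(1) unfolding D1_def by (subst (asm) sum_nonneg_eq_0_iff) (use D1_nonneg in auto)
      then show ?thesis using that by simp
    qed
    have Yz: "Y v = z v" if v: "g \<le> v" "v < n" for v
    proof -
      have "\<forall>v\<in>{g..<n}. Y v * (Y v - z v) = 0"
        using D0(2) unfolding D2_def by (subst (asm) sum_nonneg_eq_0_iff) (use D2_nonneg in auto)
      then have "Y v = 0 \<or> Y v = z v" using v by simp
      then show ?thesis using zY[OF v] z0[of v] by auto
    qed
    \<comment> \<open>Equality makes \<open>y\<close> a minimizer of the Rayleigh quotient, hence an
      eigenvector of \<open>U\<close> for the same \<open>\<mu>\<close>, so the cycle equations for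
      \<open>x\<close> and \<open>y\<close> can be compared.\<close>
    have ev: "edge_form U y f = \<mu> * vertex_form U y f" for f
      using minimizer_imp_eigenvector[of \<mu> U y f] q_le diff D0 eq by simp
    interpret E: rooted_cycle_eigenvector n g "broom_parent n k" y \<mu>
      by unfold_locales (use ev in \<open>simp add: U_def\<close>)
    have Ew: "E.w v = \<sigma> * z v" if "g \<le> v" "v < n" for v
    proof -
      have "E.w v = \<sigma> * (B.sg v * (B.sg v * Y v))" using that by (simp add: E.w_def y_def mult_ac)
      then show ?thesis using Yz[OF that] by simp
    qed
    \<comment> \<open>If \<open>x\<close> vanished on the cycle, the equation at
      \<open>g - 1\<close> would give sum 0 to the values \<open>E.w\<close> on the broom. These are
      \<open>\<sigma>\<close> times nonnegative numbers, so \<open>x\<close> would be zero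
      everywhere.\<close>
    have M_pos: "0 < M"
    proof (rule ccontr)
      assume "\<not> 0 < M"
      then have "M = 0" using M0 by simp
      then have x0: "x i = 0" if "i < g" for i using max[OF that] by (simp add: M_def)
      have "{v \<in> {g..<n}. B.root v = g - 1} = {g..<n}" using B.root_broom by auto
      moreover have "B.cycle_form y f = 0" for f
        unfolding cyc unfolding R.cycle_form_def using x0 R.Suc_mod_less by simp
      ultimately have "(\<Sum>v=g..<n. E.w v) = 0"
        using E.cycle_form_unit[of "g - 1"] g3 mu x0[of "g - 1"] by (simp add: y_def)
      then have "\<sigma> * (\<Sum>v=g..<n. z v) = 0" using Ew by (simp add: sum_distrib_left)
      then have "(\<Sum>v=g..<n. z v) = 0" using sig by auto
      then have "\<forall>v\<in>{g..<n}. z v = 0"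
        by (subst (asm) sum_nonneg_eq_0_iff) (auto simp: z0)
      then have "x v = 0" if "v < n" for v
        using x0[of v] that by (cases "v < g") (auto simp: z_def)
      then show False using nz by blast
    qed
    have z_pos: "0 < z v" if "g \<le> v" "v < n" for v
      using Yz[OF that] YM[of v] M_pos by simp
    \<comment> \<open>At another root \<open>c\<close> the broom has no tree while the cycle values
      agree, so the values \<open>R.w\<close> on the tree at \<open>c\<close> must sum to 0; but
      vanishing of \<open>D1\<close> makes each of them, times \<open>x c\<close>, positive.\<close>
    have root_eq: "R.root v = g - 1" if v: "g \<le> v" "v < n" for v
    proof (rule ccontr)
      define c where "c = R.root v"
      assume "R.root v \<noteq> g - 1"
      then have c: "c < g" "c \<noteq> g - 1" using R.root_less[OF v(2)] by (auto simp: c_def)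
      let ?S = "{v \<in> {g..<n}. R.root v = c}"
      have none: "{v \<in> {g..<n}. B.root v = c} = {}" using B.root_broom c by auto
      then have "R.cycle_form x (\<lambda>u. if u = c then 1 else 0) = \<mu> * x c"
        using E.cycle_form_unit[OF c(1)] c(1) unfolding cyc none by (simp add: y_def)
      then have "(\<Sum>v\<in>?S. R.w v) = 0" using R.cycle_form_unit[OF c(1)] mu by simp
      then have "(\<Sum>v\<in>?S. R.w v) * x c = 0" by simp
      then have "(\<Sum>v\<in>?S. R.w v * x c) = 0" by (simp only: sum_distrib_right)
      moreover have "(\<Sum>v\<in>?S. R.w v * x c) > 0"
      proof (rule sum_pos)
        show "?S \<noteq> {}" using v by (auto simp: c_def)
        fix v assume "v \<in> ?S"
        then have "R.w v * x c = M * z v" using w0[of v] c(1) by auto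
        then show "0 < R.w v * x c" using M_pos z_pos[of v] \<open>v \<in> ?S\<close> by simp
      qed simp
      ultimately show False by simp
    qed
    \<comment> \<open>Equality of the sums with positive weights \<open>z\<close> forces the common
      ancestor counts to agree; the diagonal term \<open>u = v\<close> gives the depths.\<close>
    have card_eq: "card (R.anc v) = card (B.anc v)" if v: "g \<le> v" "v < n" for v
    proof -
      have "?N v = ?N' v"
      proof (rule antisym[OF N_le[OF v]])
        have "\<mu> * ?N' v \<le> \<mu> * ?N v" using zN[OF v(2)] Yz[OF v] unfolding Y_eq by simp
        then show "?N' v \<le> ?N v" using mu by simp
      qed
      then have "(\<Sum>u=g..<n. (real (card (B.anc u \<inter> B.anc v)) - real (card (R.anc u \<inter> R.anc v))) * z u) = 0"
        by (simp add: left_diff_distrib sum_subtractf)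
      then have all0: "\<forall>u\<in>{g..<n}. (real (card (B.anc u \<inter> B.anc v)) - real (card (R.anc u \<inter> R.anc v))) * z u = 0"
        using card_le v z0 by (subst (asm) sum_nonneg_eq_0_iff) auto
      show ?thesis using bspec[OF all0, of v] v z_pos[OF v] by simp
    qed
    have pv: "p v < v" "p v < n" using R.parent_less[OF v] v by auto
    have Rc: "card (B.anc v) = Suc (card (R.anc (p v)))"
      using R.card_anc_tail[OF v] card_eq[OF v] by simp
    \<comment> \<open>In the broom only the greatest depth can belong to several vertices. A parent
      off the cycle has smaller depth, so its depth determines it.\<close>
    have Bc: "card (B.anc w) = (if w < n - k then w + 1 - g else n + 1 - g - k)"
      if "g \<le> w" "w < n" for w
      using B.anc_broom[OF that] B.kn B.gn by (auto simp: Suc_diff_le)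
    show ?thesis
    proof (cases "p v < g")
      case True
      then have "p v = g - 1" using R.root_tail[OF v] root_eq[OF v] by simp
      moreover have "card (B.anc v) = 1" using Rc True by simp
      ultimately show ?thesis using Bc[OF v] v B.kn B.gn B.k1 g3
        by (auto simp: broom_parent_def split: if_splits)
    next
      case False
      then have "card (R.anc (p v)) = card (B.anc (p v))" using card_eq pv by simp
      then have "(if v < n - k then v + 1 - g else n + 1 - g - k)
          = Suc (if p v < n - k then p v + 1 - g else n + 1 - g - k)"
        using Rc Bc[OF v] Bc[of "p v"] False pv by simp
      moreover have "k + g \<le> n" using B.kn B.gn by simp
      ultimately have "p v = (if v < n - k then v - 1 else n - k - 1)"
        using False v pv B.k1 by (auto split: if_splits)
      then show ?thesis using v B.k1 by (auto simp: broom_parent_def)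
    qed
  qed
qed


subsection \<open>Domination\<close>

lemma domination_number_le:
  assumes "finite (pverts G)" "dominating_set G S"
  shows "domination_number G \<le> card S"
proof -
  have "{S. dominating_set G S} \<subseteq> Pow (pverts G)" by (auto simp: dominating_set_def)
  then have "finite {S. dominating_set G S}" using assms(1) by (simp add: finite_subset)
  then show ?thesis unfolding domination_number_def using assms(2) by (intro Min_le) auto
qed

lemma domination_number_attained:
  assumes "finite (pverts G)"
  obtains S where "dominating_set G S" "card S = domination_number G"
proof -
  have "{S. dominating_set G S} \<subseteq> Pow (pverts G)" by (auto simp: dominating_set_def)
  then have "finite {S. dominating_set G S}" using assms by (simp add: finite_subset)
  moreover have "dominating_set G (pverts G)" by (simp add: dominating_set_def)
  ultimately have "domination_number G \<in> card ` {S. dominating_set G S}"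
    unfolding domination_number_def by (intro Min_in) auto
  then show thesis using that by auto
qed

section \<open>Transport along a graph isomorphism\<close>

locale graph_relabelling =
  fixes G :: "'a pair_pre_digraph" and H :: "'b pair_pre_digraph" and h :: "'b \<Rightarrow> 'a"
  assumes G: "pair_graph G" and H: "pair_graph H"
    and bij: "bij_betw h (pverts H) (pverts G)"
    and parcs_eq: "parcs G = map_prod h h ` parcs H"
begin

lemma parcs_H: "parcs H \<subseteq> pverts H \<times> pverts H"
proof -
  interpret pair_graph H by (rule H)
  show ?thesis by (auto dest: in_arcsD1 in_arcsD2)
qed

lemma inj_h: "inj_on h (pverts H)"
  using bij by (rule bij_betw_imp_inj_on)

lemma inj_arcs: "inj_on (map_prod h h) (parcs H)"
  using map_prod_inj_on[OF inj_h inj_h] parcs_H by (rule inj_on_subset)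

lemma vertex_form_relabel: "vertex_form G x y = vertex_form H (x \<circ> h) (y \<circ> h)"
  unfolding vertex_form_def using sum.reindex_bij_betw[OF bij, of "\<lambda>v. x v * y v"] by simp

lemma edge_form_relabel: "edge_form G x y = edge_form H (x \<circ> h) (y \<circ> h)"
  unfolding edge_form_def parcs_eq by (simp add: sum.reindex[OF inj_arcs] split_beta)

lemma edge_form_cong:
  "(\<And>v. v \<in> pverts H \<Longrightarrow> y v = y' v) \<Longrightarrow> edge_form H x y = edge_form H x y'"
  unfolding edge_form_def using parcs_H by (intro arg_cong[of _ _ "\<lambda>t. t / 2"] sum.cong) auto

lemma eigenvector_relabel:
  assumes "\<And>y. edge_form G x y = \<mu> * vertex_form G x y"
  shows "edge_form H (x \<circ> h) y = \<mu> * vertex_form H (x \<circ> h) y"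
proof -
  define y' where "y' = y \<circ> the_inv_into (pverts H) h"
  have y: "(y' \<circ> h) v = y v" if "v \<in> pverts H" for v
    using the_inv_into_f_f[OF inj_h that] by (simp add: y'_def)
  have "edge_form H (x \<circ> h) (y' \<circ> h) = edge_form H (x \<circ> h) y"
    using y by (rule edge_form_cong)
  moreover have "vertex_form H (x \<circ> h) (y' \<circ> h) = vertex_form H (x \<circ> h) y"
    unfolding vertex_form_def using y by (intro sum.cong) auto
  ultimately show ?thesis using assms[of y'] by (simp add: edge_form_relabel vertex_form_relabel)
qed

lemma dominating_set_relabel:
  assumes "dominating_set G S"
  obtains S' where "dominating_set H S'" "card S' = card S"
proof
  let ?S = "{v \<in> pverts H. h v \<in> S}"
  have S: "S \<subseteq> pverts G" using assms by (simp add: dominating_set_def)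
  have "h ` ?S = S" using S bij_betw_imp_surj_on[OF bij] by force
  moreover have "inj_on h ?S" using inj_h by (rule inj_on_subset) auto
  ultimately show "card ?S = card S" by (metis card_image)
  show "dominating_set H ?S"
    unfolding dominating_set_def
  proof (intro conjI ballI)
    fix v assume v: "v \<in> pverts H - ?S"
    then have "h v \<in> pverts G - S" using bij_betw_apply[OF bij] by auto
    then obtain u where u: "u \<in> S" "(h v, u) \<in> parcs G" using assms by (auto simp: dominating_set_def)
    then obtain a b where ab: "(a, b) \<in> parcs H" "h a = h v" "u = h b" by (auto simp: parcs_eq)
    then have "a = v" using inj_onD[OF inj_h, of a v] parcs_H v by auto
    then show "\<exists>u\<in>?S. (v, u) \<in> parcs H" using ab u(1) parcs_H by auto
  qed auto
qed

lemma digraph_iso_relabel: "digraph_iso (with_proj G) (with_proj H)"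
proof -
  interpret G: pair_graph G by (rule G)
  define i where "i = the_inv_into (pverts H) h"
  have ih: "i (h v) = v" if "v \<in> pverts H" for v
    using the_inv_into_f_f[OF inj_h that] by (simp add: i_def)
  have inj_i: "inj_on i (pverts G)" and i_img: "i ` pverts G = pverts H"
    using bij_betw_the_inv_into[OF bij] by (auto simp: i_def bij_betw_def)
  define f where "f = \<lparr>iso_verts = i, iso_arcs = map_prod i i, iso_head = snd, iso_tail = fst\<rparr>"
  have sub: "parcs G \<subseteq> pverts G \<times> pverts G" by (auto dest: G.in_arcsD1 G.in_arcsD2)
  have "inj_on (map_prod i i) (parcs G)"
    using map_prod_inj_on[OF inj_i inj_i] sub by (rule inj_on_subset)
  then have "G.digraph_isomorphism f"
    unfolding G.digraph_isomorphism_def using inj_i G.wf_digraph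
    by (auto simp: f_def with_proj_def)
  moreover have "map_prod i i ` parcs G = parcs H"
  proof -
    have "map_prod i i ` parcs G = (\<lambda>e. e) ` parcs H"
      unfolding parcs_eq image_image using parcs_H by (intro image_cong) (auto simp: ih)
    then show ?thesis by simp
  qed
  then have "with_proj H = app_iso f (with_proj G)"
    using i_img by (simp add: app_iso_def f_def with_proj_def)
  ultimately show ?thesis unfolding digraph_iso_def by blast
qed

end

text \<open>This lets a cycle vertex with the largest absolute eigenvector entry come last, at the
  place where the broom is attached.\<close>

lemma cycle_list_rotate:
  assumes "cycle_list G vs"
  shows "cycle_list G (rotate m vs)"
proof -
  define g where "g = length vs"
  have vs: "3 \<le> g" "distinct vs" "\<And>i. i < g \<Longrightarrow> (vs ! i, vs ! (Suc i mod g)) \<in> parcs G"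
    using assms by (auto simp: cycle_list_def g_def)
  have "(rotate m vs ! i, rotate m vs ! (Suc i mod g)) \<in> parcs G" if "i < g" for i
  proof -
    have "rotate m vs ! i = vs ! ((m + i) mod g)"
      using that by (simp add: nth_rotate g_def)
    moreover have "rotate m vs ! (Suc i mod g) = vs ! ((m + Suc i mod g) mod g)"
      using vs(1) by (subst nth_rotate) (simp_all flip: g_def)
    moreover have "(m + Suc i mod g) mod g = Suc ((m + i) mod g) mod g"
      by (simp add: mod_simps)
    ultimately show ?thesis using vs(3)[of "(m + i) mod g"] vs(1) by simp
  qed
  then show ?thesis using vs by (simp add: cycle_list_def g_def)
qed

text \<open>With one leaf fewer the centre moves one step out, from \<open>c - 1\<close> to
  \<open>c\<close>, where \<open>c = n - k - 1\<close>. Adding \<open>c\<close> to a dominating set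
  takes care of \<open>c - 1\<close>, \<open>c\<close> and the leaves, the vertices whose
  neighbourhoods change.\<close>

lemma domination_number_U_step:
  assumes "3 \<le> g" "g < n" "1 \<le> k" "Suc k \<le> n - g"
  shows "domination_number (U_graph n k g) \<le> domination_number (U_graph n (Suc k) g) + 1"
proof -
  interpret A: broom_cycle n g k by unfold_locales (use assms in auto)
  interpret B: broom_cycle n g "Suc k" by unfold_locales (use assms in auto)
  have eq: "U_graph n k g = A.T" "U_graph n (Suc k) g = B.T"
    using assms by (simp_all add: U_graph_eq)
  have fin: "finite (pverts A.T)" "finite (pverts B.T)" by (simp_all add: A.pverts_T B.pverts_T)
  obtain S where S: "dominating_set B.T S" "card S = domination_number B.T"
    using domination_number_attained[OF fin(2)] .
  have sub: "S \<subseteq> {..<n}" and dom: "\<And>v. v < n \<Longrightarrow> v \<notin> S \<Longrightarrow> \<exists>u\<in>S. (v, u) \<in> parcs B.T"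
    using S(1) by (auto simp: dominating_set_def B.pverts_T)
  define c where "c = n - k - 1"
  have c: "g \<le> c" "c < n" "n - k = Suc c" using assms by (auto simp: c_def)
  have bA: "broom_parent n k v = min (v - 1) c" and bB: "broom_parent n (Suc k) v = min (v - 1) (c - 1)"
    for v by (auto simp: broom_parent_def c_def)
  have "\<exists>u\<in>insert c S. (v, u) \<in> parcs A.T" if v: "v < n" "v \<notin> insert c S" for v
  proof (cases "v < c")
    case True
    obtain u where u: "u \<in> S" "(v, u) \<in> parcs B.T" using dom v by auto
    then have un: "u < n" using sub by auto
    consider "v < g" "u = Suc v mod g" | "u < g" "v = Suc u mod g"
      | "g \<le> v" "u = min (v - 1) (c - 1)" | "g \<le> u" "v = min (u - 1) (c - 1)"
      using u(2) unfolding B.parcs_T_iff bB by auto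
    then show ?thesis
    proof cases
      case 3
      then have "u = min (v - 1) c" using True by auto
      then show ?thesis using 3 v u(1) unfolding A.parcs_T_iff bA by auto
    next
      case 4
      show ?thesis
      proof (cases "u \<le> c")
        case True
        then have "v = min (u - 1) c" using 4 by auto
        then show ?thesis using 4 un u(1) unfolding A.parcs_T_iff bA by auto
      next
        case False
        then have "v = min (c - 1) c" using 4 by auto
        then show ?thesis using c unfolding A.parcs_T_iff bA by auto
      qed
    qed (use u(1) in \<open>auto simp: A.parcs_T_iff\<close>)
  next
    case False
    then have "c = min (v - 1) c" using v by auto
    then show ?thesis using v c False unfolding A.parcs_T_iff bA by auto
  qed
  then have "dominating_set A.T (insert c S)"
    using sub c by (auto simp: dominating_set_def A.pverts_T)
  then have "domination_number A.T \<le> card (insert c S)" by (rule domination_number_le[OF fin(1)])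
  also have "\<dots> \<le> card S + 1" by (rule order_trans[OF card_insert_le_m1]) auto
  finally show ?thesis unfolding eq using S(2) by simp
qed

text \<open>For \<open>k = n - g\<close> the centre is the cycle vertex \<open>g - 1\<close>.
  Counting down from it in steps of three dominates the cycle and, through the centre, the
  leaves.\<close>

lemma domination_number_U_max:
  assumes "3 \<le> g" "g < n"
  shows "domination_number (U_graph n (n - g) g) \<le> (g + 2) div 3"
proof -
  interpret A: broom_cycle n g "n - g" by unfold_locales (use assms in auto)
  have eq: "U_graph n (n - g) g = A.T" using assms by (simp add: U_graph_eq)
  define S where "S = (\<lambda>j. g - 1 - 3 * j) ` {..(g - 1) div 3}"
  have mem: "g - 1 - 3 * j \<in> S" if "3 * j \<le> g - 1" for j using that by (auto simp: S_def)
  have last: "g - 1 \<in> S" using mem[of 0] by simp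
  have "\<exists>u\<in>S. (v, u) \<in> parcs A.T" if v: "v < n" "v \<notin> S" for v
  proof (cases "v < g")
    case False
    then have "broom_parent n (n - g) v = g - 1" using assms by (auto simp: broom_parent_def)
    then show ?thesis using False v last unfolding A.parcs_T_iff by auto
  next
    case True
    define q where "q = (g - 1 - v) div 3"
    consider "g - 1 - v = 3 * q" | "g - 1 - v = 3 * q + 1" | "g - 1 - v = 3 * q + 2"
      unfolding q_def by linarith
    then show ?thesis
    proof cases
      case 1
      then have "v = g - 1 - 3 * q" "3 * q \<le> g - 1" using True by auto
      then show ?thesis using mem v by auto
    next
      case 2
      then have "Suc v = g - 1 - 3 * q" "3 * q \<le> g - 1" "Suc v < g" using True by auto
      then have "Suc v \<in> S" "Suc v mod g = Suc v" using mem by auto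
      then show ?thesis using True unfolding A.parcs_T_iff by metis
    next
      case 3
      \<comment> \<open>A vertex two below a chosen one is dominated by \<open>v - 1\<close>, the
        next chosen vertex, except that 0 is dominated by \<open>g - 1\<close> across the
        wrap-around.\<close>
      show ?thesis
      proof (cases "v = 0")
        case True
        then have "v = Suc (g - 1) mod g" "g - 1 < g" using assms by auto
        then have "(v, g - 1) \<in> parcs A.T" unfolding A.parcs_T_iff by metis
        then show ?thesis using last by blast
      next
        case False
        then have u: "v - 1 = g - 1 - 3 * Suc q" "3 * Suc q \<le> g - 1" using 3 True by auto
        then have "v - 1 \<in> S" using mem by metis
        moreover have "v = Suc (v - 1) mod g" "v - 1 < g" using False True by auto
        then have "(v, v - 1) \<in> parcs A.T" unfolding A.parcs_T_iff by metis
        ultimately show ?thesis by blast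
      qed
    qed
  qed
  moreover have "S \<subseteq> {..<n}" using assms by (auto simp: S_def)
  ultimately have "dominating_set A.T S" by (auto simp: dominating_set_def A.pverts_T)
  then have "domination_number A.T \<le> card S" by (rule domination_number_le[rotated]) (simp add: A.pverts_T)
  also have "card S \<le> card {..(g - 1) div 3}" unfolding S_def by (rule card_image_le) simp
  also have "\<dots> = (g + 2) div 3" using assms by (simp add: div_if)
  finally show ?thesis by (simp add: eq)
qed

text \<open>A discrete intermediate value argument: from \<open>m\<close> to \<open>m + 1\<close>
  the domination number drops by at most one, so it cannot skip \<open>\<gamma>\<close>. The bound
  \<open>k \<le> m\<close> later contradicts minimality.\<close>

lemma domination_number_U_intermediate:
  assumes "3 \<le> g" "g < n" "1 \<le> m" "m \<le> n - g"
    and "domination_number (U_graph n m g) \<le> \<gamma>" "\<gamma> \<le> domination_number (U_graph n 1 g)"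
  obtains k where "1 \<le> k" "k \<le> m" "domination_number (U_graph n k g) = \<gamma>"
proof -
  have "\<exists>k. 1 \<le> k \<and> k \<le> m \<and> domination_number (U_graph n k g) = \<gamma>"
    using assms(3-5)
  proof (induction m rule: dec_induct)
    case base
    then show ?case using assms(6) by (intro exI[of _ 1]) simp
  next
    case (step m)
    show ?case
    proof (cases "domination_number (U_graph n m g) \<le> \<gamma>")
      case True
      then show ?thesis using step by (metis Suc_leD le_SucI)
    next
      case False
      then have "domination_number (U_graph n (Suc m) g) = \<gamma>"
        using domination_number_U_step[OF assms(1,2) step(1)] step.prems by simp
      then show ?thesis by (intro exI[of _ "Suc m"]) simp
    qed
  qed
  then show thesis using that by blast
qed

section \<open>Retraction of a deep graph onto a broom\<close>

context rooted_cycle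
begin

lemma ancestor_of_depth:
  assumes "1 \<le> d" "d \<le> card (anc v)"
  obtains a where "a \<in> anc v" "card (anc a) = d"
proof -
  have "\<exists>a\<in>anc v. card (anc a) = d"
    using assms
  proof (induction v rule: less_induct)
    case (less v)
    then have "anc v \<noteq> {}" by auto
    then have v: "g \<le> v" "v < n" using anc_eq_empty[of v] by blast+
    show ?case
    proof (cases "card (anc v) = d")
      case True
      then show ?thesis using self_in_anc[OF v] by blast
    next
      case False
      then have "d \<le> card (anc (p v))" using less.prems card_anc_tail[OF v] by simp
      then show ?thesis using less.IH[OF parent_less[OF v]] less.prems anc_tail[OF v] by auto
    qed
  qed
  then show thesis using that by blast
qed

lemma anc_lt_n: "a \<in> anc v \<Longrightarrow> g \<le> a \<and> a < n"
proof (induction v rule: less_induct)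
  case (less v)
  then have v: "g \<le> v" "v < n" using anc_eq_empty[of v] by auto
  then show ?case using less parent_less[OF v] anc_tail[OF v] by auto
qed

lemma parent_in_anc: "a \<in> anc v \<Longrightarrow> g \<le> p a \<Longrightarrow> p a \<in> anc v"
proof (induction v rule: less_induct)
  case (less v)
  then have v: "g \<le> v" "v < n" using anc_eq_empty[of v] by auto
  have "p v \<in> anc (p v)" if "g \<le> p v" using self_in_anc[OF that] parent_lt_n[OF v] by simp
  then show ?case using less parent_less[OF v] anc_tail[OF v] by auto
qed

lemma root_anc: "a \<in> anc v \<Longrightarrow> root a = root v"
proof (induction v rule: less_induct)
  case (less v)
  then have v: "g \<le> v" "v < n" using anc_eq_empty[of v] by auto
  then show ?case using less parent_less[OF v] anc_tail[OF v] root_tail[OF v] by auto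
qed

text \<open>
  Retract the graph onto its cycle and one path of the given length leaving the cycle, moving the
  end of the path to its neighbour; this maps a dominating set to one of the broom.
\<close>
lemma domination_number_U_le_card:
  assumes k: "1 \<le> k" "k \<le> n - g" and gn: "g < n"
    and depth: "n + 1 - g - k \<le> card (anc v0)" and S: "dominating_set T S"
  shows "domination_number (U_graph n k g) \<le> card S"
proof -
  interpret B: broom_cycle n g k by unfold_locales (use g_ge_3 k gn in auto)
  define D c where "D = n + 1 - g - k" and "c = n - k - 1"
  have D: "1 \<le> D" "c = g - 1 + (D - 1)" "n - k = Suc c" "c < n" "g \<le> Suc c"
    using k gn g_ge_3 by (auto simp: D_def c_def)
  obtain u where u: "u \<in> anc v0" and Du: "card (anc u) = D"
    using ancestor_of_depth[OF D(1)] depth by (metis D_def)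
  have ug: "g \<le> u" "u < n" using anc_lt_n[OF u] by auto
  \<comment> \<open>Rotation by \<open>s\<close> carries the root of the path to
    \<open>g - 1\<close>.\<close>
  define s where "s = g - 1 - root u"
  have rs: "(root u + s) mod g = g - 1" using root_less[OF ug(2)] by (simp add: s_def)
  \<comment> \<open>Off the cycle a vertex goes to the path vertex of its depth. The cap at
    \<open>D - 1\<close> sends the end \<open>u\<close>, of depth \<open>D\<close>, to the centre
    \<open>c\<close>, together with the vertex before it.\<close>
  define \<tau> where "\<tau> v = (if v < g then (v + s) mod g else g - 1 + min (card (anc v)) (D - 1))" for v
  \<comment> \<open>On the cycle and the path this is \<open>\<tau>\<close>; a vertex attached to
    them goes to the image of its parent. Vertices further away dominate nothing there, so their
    images only have to lie in the graph.\<close>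
  define \<sigma> where "\<sigma> v = (if v < g \<or> v \<in> anc u then \<tau> v else \<tau> (p v))" for v
  have \<tau>_lt: "\<tau> v \<le> c" for v
  proof (cases "v < g")
    case True
    have "(v + s) mod g < g" using g_ge_3 by simp
    then have "(v + s) mod g \<le> c" using D(5) by linarith
    then show ?thesis using True by (simp add: \<tau>_def)
  qed (simp add: \<tau>_def D(2))
  have \<tau>_root: "\<tau> (p a) = g - 1" "card (anc a) = 1" if "a \<in> anc u" "p a < g" for a
  proof -
    have a: "g \<le> a" "a < n" using anc_lt_n that by auto
    then have "p a = root u" using root_anc[OF that(1)] root_tail[OF a] that(2) by simp
    then show "\<tau> (p a) = g - 1" using rs that(2) by (simp add: \<tau>_def)
    show "card (anc a) = 1" using card_anc_tail[OF a] that(2) by simp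
  qed
  have card_p: "card (anc a) = Suc (card (anc (p a)))" if "a \<in> anc u" for a
    using anc_lt_n[OF that] card_anc_tail by simp
  have dom: "\<exists>t\<in>S. (v, t) \<in> parcs T" if "v < n" "v \<notin> S" for v
    using S that by (auto simp: dominating_set_def pverts_T)
  have Ssub: "S \<subseteq> {..<n}" using S by (auto simp: dominating_set_def pverts_T)
  have bc: "broom_parent n k v = min (v - 1) c" for v by (simp add: broom_parent_def c_def)
  \<comment> \<open>Domination is inherited: a dominator of \<open>w\<close> is mapped to
    \<open>w'\<close> itself or to a neighbour of it. The assumption \<open>tail\<close> excludes
    the end \<open>u\<close> of the path.\<close>
  have inner: "w' \<in> \<sigma> ` S \<or> (\<exists>t\<in>\<sigma> ` S. (w', t) \<in> parcs B.T)"
    if H: "w < g \<or> w \<in> anc u" and w': "\<tau> w = w'" and tail: "g \<le> w \<Longrightarrow> card (anc w) \<le> D - 1"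
    for w w'
  proof (cases "w \<in> S")
    case True
    then have "\<sigma> w \<in> \<sigma> ` S" by simp
    then show ?thesis using H w' by (simp add: \<sigma>_def)
  next
    case False
    have "w < n" using H anc_lt_n g_le_n by auto
    then obtain t where t: "t \<in> S" "(w, t) \<in> parcs T" using dom False by auto
    then have tn: "t < n" using Ssub by auto
    have "\<sigma> t = w' \<or> (w', \<sigma> t) \<in> parcs B.T"
    proof -
      consider (succ) "w < g" "t = Suc w mod g" | (pred) "t < g" "w = Suc t mod g"
        | (up) "g \<le> w" "w < n" "t = p w" | (down) "g \<le> t" "t < n" "w = p t"
        using t(2) unfolding parcs_T_iff by auto
      then show ?thesis
      proof cases
        case succ
        then have "\<sigma> t = Suc w' mod g" "w' < g"
          using Suc_mod_less[of w] w' by (auto simp: \<sigma>_def \<tau>_def mod_simps)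
        then show ?thesis unfolding B.parcs_T_iff by simp
      next
        case pred
        then have "w' = Suc (\<sigma> t) mod g" "\<sigma> t < g"
          using Suc_mod_less[of t] w' by (auto simp: \<sigma>_def \<tau>_def mod_simps)
        then show ?thesis unfolding B.parcs_T_iff by simp
      next
        case up
        then have wa: "w \<in> anc u" using H by simp
        have w'_eq: "w' = g - 1 + card (anc w)" using w' tail up by (simp add: \<tau>_def)
        have "\<sigma> t = w' - 1"
        proof (cases "p w < g")
          case True
          then show ?thesis using \<tau>_root[OF wa True] w'_eq up by (simp add: \<sigma>_def)
        next
          case False
          then have "p w \<in> anc u" using parent_in_anc[OF wa] by simp
          then show ?thesis using False up card_p[OF wa] tail w'_eq by (simp add: \<sigma>_def \<tau>_def)
        qed
        moreover have "g \<le> w'" "w' \<le> c" using w'_eq card_p[OF wa] \<tau>_lt[of w] w' g_ge_3 by auto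
        ultimately have "g \<le> w'" "w' < n" "\<sigma> t = min (w' - 1) c" using D(4) by simp_all
        then show ?thesis unfolding B.parcs_T_iff bc by blast
      next
        case down
        show ?thesis
        proof (cases "t \<in> anc u")
          case False
          then show ?thesis using down w' by (simp add: \<sigma>_def)
        next
          case True
          have w'_eq: "w' = g - 1 + card (anc w)"
          proof (cases "w < g")
            case True
            then show ?thesis using \<tau>_root[OF \<open>t \<in> anc u\<close>] down w' by simp
          qed (use w' tail in \<open>simp add: \<tau>_def\<close>)
          have "\<sigma> t = g - 1 + min (Suc (card (anc w))) (D - 1)"
            using True down card_p[OF True] by (simp add: \<sigma>_def \<tau>_def)
          then have st: "\<sigma> t = min (Suc w') c" unfolding w'_eq D(2) by linarith
          show ?thesis
          proof (cases "w' < c")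
            case True
            then have "\<sigma> t = Suc w'" "g \<le> Suc w'" "Suc w' < n"
              using st w'_eq D g_ge_3 by auto
            then show ?thesis using True unfolding B.parcs_T_iff bc by simp
          next
            case False
            then show ?thesis using st \<tau>_lt[of w] w' by simp
          qed
        qed
      qed
    qed
    then show ?thesis using t(1) by blast
  qed
  \<comment> \<open>The whole closed neighbourhood of \<open>u\<close> is mapped to
    \<open>c\<close>, so whichever vertex of \<open>S\<close> dominates \<open>u\<close> puts
    \<open>c\<close> into the image, and \<open>c\<close> dominates the leaves of the broom. This is
    the reason for the cap in \<open>\<tau>\<close>.\<close>
  have centre: "c \<in> \<sigma> ` S"
  proof -
    have uu: "u \<in> anc u" using self_in_anc[OF ug] .
    have \<tau>u: "\<tau> u = c" using ug Du D by (simp add: \<tau>_def)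
    obtain t where t: "t \<in> S" "t = u \<or> (u, t) \<in> parcs T"
      using dom[OF ug(2)] by auto
    have "\<not> u < g" "u \<noteq> Suc t mod g" using ug(1) Suc_mod_less[of t] by auto
    with t(2) consider "t = u" | "t = p u" | "g \<le> t" "t < n" "u = p t"
      unfolding parcs_T_iff by blast
    then have "\<sigma> t = c"
    proof cases
      case 1
      then show ?thesis using \<tau>u uu by (simp add: \<sigma>_def)
    next
      case 2
      show ?thesis
      proof (cases "p u < g")
        case True
        then show ?thesis using \<tau>_root[OF uu True] 2 Du D by (simp add: \<sigma>_def)
      next
        case False
        then have "p u \<in> anc u" using parent_in_anc[OF uu] by simp
        then show ?thesis using False 2 card_p[OF uu] Du D by (simp add: \<sigma>_def \<tau>_def)
      qed
    next
      case 3
      then have "u < t" using parent_less by simp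
      then have "t \<notin> anc u" using anc_subset[of u] by auto
      then show ?thesis using 3 \<tau>u by (simp add: \<sigma>_def)
    qed
    then show ?thesis using t(1) by (metis imageI)
  qed
  have "dominating_set B.T (\<sigma> ` S)"
    unfolding dominating_set_def B.pverts_T
  proof (intro conjI ballI subsetI)
    fix v assume "v \<in> \<sigma> ` S"
    then show "v \<in> {..<n}" using \<tau>_lt D(4) by (auto simp: \<sigma>_def intro: le_less_trans)
  next
    fix v assume v: "v \<in> {..<n} - \<sigma> ` S"
    show "\<exists>t\<in>\<sigma> ` S. (v, t) \<in> parcs B.T"
    proof (cases "v < g")
      case True
      \<comment> \<open>The preimage of \<open>v\<close> under the rotation.\<close>
      define w where "w = (v + (g - s)) mod g"
      have "s < g" using g_ge_3 by (simp add: s_def)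
      have "(w + s) mod g = (v + (g - s) + s) mod g" by (simp add: w_def mod_simps)
      also have "\<dots> = v" using \<open>s < g\<close> True by simp
      finally have "\<tau> w = v" "w < g" using g_ge_3 by (auto simp: \<tau>_def w_def)
      then show ?thesis using inner[of w v] v by auto
    next
      case False
      show ?thesis
      proof (cases "v \<le> c")
        case True
        have "1 \<le> v + 1 - g" "v + 1 - g \<le> card (anc u)"
          using False True D(1,2) Du g_ge_3 by linarith+
        then obtain a where a: "a \<in> anc u" "card (anc a) = v + 1 - g"
          using ancestor_of_depth by blast
        have "g \<le> a" using anc_lt_n[OF a(1)] by simp
        then have "\<tau> a = g - 1 + min (v + 1 - g) (D - 1)" using a(2) by (simp add: \<tau>_def)
        then have "\<tau> a = v" using True False D(2) g_ge_3 by linarith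
        moreover have "card (anc a) \<le> D - 1" using a(2) True False D(2) g_ge_3 by linarith
        ultimately show ?thesis using inner[of a v] a(1) v by auto
      next
        case vc: False
        then have "broom_parent n k v = c" by (simp add: bc)
        then show ?thesis using centre False v unfolding B.parcs_T_iff by auto
      qed
    qed
  qed
  then have "domination_number B.T \<le> card (\<sigma> ` S)"
    by (rule domination_number_le[rotated]) (simp add: B.pverts_T)
  also have "\<dots> \<le> card S" using Ssub by (intro card_image_le) (simp add: finite_subset)
  finally show ?thesis using U_graph_eq[OF g_ge_3 gn k] by simp
qed

end


subsection \<open>The minimizer in the class\<close>

theorem theorem3p8:
  fixes n g \<gamma> :: nat
  assumes "odd g" and "3 \<le> g" and "g < n"
    and "\<lceil>real g / 3\<rceil> \<le> int \<gamma>"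
    and "\<gamma> \<le> domination_number (U_graph n 1 g)"
  shows "V_graph n \<gamma> g \<in> unicyclic_class n g \<gamma> \<and>
    (\<forall>G \<in> (unicyclic_class n g \<gamma> :: 'a pair_pre_digraph set).
      q_min (V_graph n \<gamma> g) \<le> q_min G \<and>
      (q_min G = q_min (V_graph n \<gamma> g) \<longrightarrow> digraph_iso (with_proj G) (with_proj (V_graph n \<gamma> g))))"
proof -
  let ?P = "\<lambda>k. 1 \<le> k \<and> k \<le> n - g \<and> domination_number (U_graph n k g) = \<gamma>"
  define k where "k = (LEAST k. ?P k)"
  have "real g / 3 \<le> real \<gamma>" using assms(4) by (simp add: ceiling_le_iff)
  \<comment> \<open>The ceiling of \<open>g / 3\<close>, which bounds the domination number at
    \<open>k = n - g\<close>, where the star sits on the cycle.\<close>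
  then have "(g + 2) div 3 \<le> \<gamma>" by simp
  then have max: "domination_number (U_graph n (n - g) g) \<le> \<gamma>"
    using domination_number_U_max[OF assms(2,3)] by simp
  have "1 \<le> n - g" using assms(3) by simp
  then obtain k' where "1 \<le> k'" "k' \<le> n - g" "domination_number (U_graph n k' g) = \<gamma>"
    using domination_number_U_intermediate[OF assms(2,3) _ order_refl max assms(5)] by blast
  then have "?P k'" by blast
  then have k: "?P k" unfolding k_def by (rule LeastI)
  have k_least: "\<not> ?P j" if "j < k" for j using that unfolding k_def by (rule not_less_Least)
  interpret B: broom_cycle n g k by unfold_locales (use assms k in auto)
  have U: "U_graph n k g = B.T" using U_graph_eq[OF assms(2,3)] k by blast
  then have V: "V_graph n \<gamma> g = B.T" unfolding V_graph_def k_def[symmetric] .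
  have "domination_number B.T = \<gamma>" using k unfolding U by blast
  then have mem: "V_graph n \<gamma> g \<in> unicyclic_class n g \<gamma>"
    unfolding V using B.T_in_unicyclic_class by simp
  have "q_min B.T \<le> q_min G \<and>
      (q_min G = q_min B.T \<longrightarrow> digraph_iso (with_proj G) (with_proj B.T))"
    if GC: "G \<in> unicyclic_class n g \<gamma>" for G :: "'a pair_pre_digraph"
  proof -
    have uni: "unicyclic G" and card: "card (pverts G) = n" and dom: "domination_number G = \<gamma>"
      and len: "\<And>C. C \<in> graph_cycles G \<Longrightarrow> card C = g"
      using GC by (auto simp: unicyclic_class_def)
    have G: "pair_graph G" using uni by (simp add: unicyclic_def)
    obtain C where "C \<in> graph_cycles G" using uni by (auto simp: unicyclic_def)
    then obtain vs where vs: "cycle_list G vs" "C = cycle_edges vs"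
      unfolding graph_cycles_eq[OF G] by auto
    have lvs: "length vs = g" using len[OF \<open>C \<in> graph_cycles G\<close>] vs card_cycle_edges by metis
    have finG: "finite (pverts G)" using card assms by (metis card.infinite gr_implies_not0)
    have neG: "pverts G \<noteq> {}" using card assms by auto
    obtain x v where v: "v \<in> pverts G" "x v \<noteq> 0"
      and ev: "\<And>y. edge_form G x y = q_min G * vertex_form G x y"
      using q_min_eigenvector[OF G neG] by metis
    obtain r where r: "r < g" "\<And>i. i < g \<Longrightarrow> \<bar>x (vs ! i)\<bar> \<le> \<bar>x (vs ! r)\<bar>"
    proof -
      have fin: "finite ((\<lambda>i. \<bar>x (vs ! i)\<bar>) ` {..<g})" "(\<lambda>i. \<bar>x (vs ! i)\<bar>) ` {..<g} \<noteq> {}"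
        using assms(2) by (auto simp: lessThan_empty_iff)
      obtain r where "r < g" "\<bar>x (vs ! r)\<bar> = Max ((\<lambda>i. \<bar>x (vs ! i)\<bar>) ` {..<g})"
        using Max_in[OF fin] by auto
      then show thesis using that[of r] Max_ge[OF fin(1)] by auto
    qed
    \<comment> \<open>Rotating by \<open>r + 1\<close> brings \<open>vs ! r\<close> to the last
      position \<open>g - 1\<close>.\<close>
    define ws where "ws = rotate (Suc r) vs"
    have ws: "cycle_list G ws" "length ws = g"
      unfolding ws_def by (rule cycle_list_rotate[OF vs(1)]) (simp add: lvs)
    have ws_nth: "ws ! i = vs ! ((Suc r + i) mod g)" if "i < g" for i
      using nth_rotate[of i vs "Suc r"] that lvs unfolding ws_def by metis
    have ws_last: "ws ! (g - 1) = vs ! r" using ws_nth[of "g - 1"] r(1) assms(2) by simp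
    obtain h p where R: "rooted_cycle n g p" and bij: "bij_betw h {..<n} (pverts G)"
      and arcs: "parcs G = map_prod h h ` parcs (rooted_cycle_graph n g p)"
      and h: "\<And>i. i < g \<Longrightarrow> h i = ws ! i"
      using unicyclic_imp_rooted_cycle[OF uni ws(1)] unfolding card ws(2) by metis
    interpret R: rooted_cycle n g p by (rule R)
    interpret L: graph_relabelling G R.T h
      by (intro graph_relabelling.intro) (use G R.pair_graph_T bij arcs R.pverts_T in auto)
    \<comment> \<open>A deeper graph would retract onto the broom with \<open>k - 1\<close> leaves,
      whose domination number is then at most \<open>\<gamma>\<close>; some \<open>j < k\<close>
      would have domination number exactly \<open>\<gamma>\<close>, against the choice of
      \<open>k\<close>.\<close>
    have depth: "card (R.anc v) \<le> n + 1 - g - k" for v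
    proof (rule ccontr)
      assume deep: "\<not> ?thesis"
      have "R.anc v \<subseteq> {g..<n}" using R.anc_lt_n by auto
      then have "card (R.anc v) \<le> n - g" using card_mono[of "{g..<n}"] by simp
      \<comment> \<open>As no depth exceeds \<open>n - g\<close>, a violation forces
        \<open>2 \<le> k\<close>, so \<open>k - 1\<close> is admissible.\<close>
      then have k2: "1 \<le> k - 1" "k - 1 \<le> n - g" "n + 1 - g - (k - 1) \<le> card (R.anc v)"
        using deep k by auto
      obtain S where S: "dominating_set G S" "card S = \<gamma>"
        using domination_number_attained[OF finG] dom by metis
      obtain S' where S': "dominating_set R.T S'" "card S' = \<gamma>"
        using L.dominating_set_relabel[OF S(1)] S(2) by metis
      have "domination_number (U_graph n (k - 1) g) \<le> \<gamma>"
        using R.domination_number_U_le_card[OF k2(1,2) assms(3) k2(3) S'(1)] S'(2) by simp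
      then obtain j where j: "1 \<le> j" "j \<le> k - 1" "domination_number (U_graph n j g) = \<gamma>"
        using domination_number_U_intermediate[OF assms(2,3) k2(1,2) _ assms(5)] by blast
      have "j < k" using j(1,2) by linarith
      moreover have "j \<le> n - g" using j(2) k2(2) by linarith
      ultimately show False using k_least j(1,3) by blast
    qed
    have E: "rooted_cycle_eigenvector n g p (x \<circ> h) (q_min G)"
      by unfold_locales (rule L.eigenvector_relabel[OF ev])
    obtain v0 where v0: "v0 < n" "(x \<circ> h) v0 \<noteq> 0"
    proof -
      have "v \<in> h ` {..<n}" using v(1) bij_betw_imp_surj_on[OF bij] by simp
      then show thesis using that v(2) by auto
    qed
    have max: "\<bar>(x \<circ> h) i\<bar> \<le> \<bar>(x \<circ> h) (g - 1)\<bar>" if "i < g" for i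
      using r(1) r(2)[of "(Suc r + i) mod g"] that assms(2) by (simp add: h ws_last ws_nth)
    note main = q_min_broom_le[OF E B.broom_cycle_axioms assms(1) v0 depth max]
    show ?thesis
    proof (intro conjI impI)
      show "q_min B.T \<le> q_min G" using main(1) .
      assume "q_min G = q_min B.T"
      then have "p v = broom_parent n k v" if "g \<le> v" "v < n" for v
        using main(2) that by simp
      then have "(\<lambda>v. (v, p v)) ` {g..<n} = (\<lambda>v. (v, broom_parent n k v)) ` {g..<n}"
        by (intro image_cong) auto
      then have "R.T = B.T" by (simp add: rooted_cycle_graph_def)
      then show "digraph_iso (with_proj G) (with_proj B.T)" using L.digraph_iso_relabel by simp
    qed
  qed
  then show ?thesis using mem unfolding V by blast
qed

end
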